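(* Let $\Omega\subset\mathbb{C}^m$ be a bounded domain and let $K:\Omega\times\Omega\to\mathbb{C}$ be a sesqui-analytic function for which a continuous branch of $\log K$ exists on $\Omega\times\Omega$. Suppose that $K^\alpha$ and $K^\beta$ are non-negative definite for some $\alpha,\beta>0$. Let $\mathcal{R}_1:(\mathcal{H},K^\alpha)\otimes(\mathcal{H},K^\beta)\to\mathrm{Hol}(\Omega,\mathbb{C}^m)$ be the linear map $$\mathcal{R}_1(f)=\frac{1}{\sqrt{\alpha\beta(\alpha+\beta)}}\begin{pmatrix}(\beta\partial_1 f-\alpha\partial_{m+1}f)_{|\Delta}\\ \vdots\\ (\beta\partial_m f-\alpha\partial_{2m}f)_{|\Delta}\end{pmatrix},$$ and equip $\mathrm{ran}\,\mathcal{R}_1$ with the inner product $$\langle\mathcal{R}_1(f),\mathcal{R}_1(g)\rangle:=\langle P_{\mathcal{A}_0\ominus\mathcal{A}_1}f,\,P_{\mathcal{A}_0\ominus\mathcal{A}_1}g\rangle,\qquad f,g\in(\mathcal{H},K^\alpha)\otimes(\mathcal{H},K^\beta).$$ Then the Hilbert space $(\mathcal{H},\mathbb{K}^{(\alpha,\beta)})$ determined by the non-negative definite kernel $\mathbb{K}^{(\alpha,\beta)}$ coincides with the space $\mathrm{ran}\,\mathcal{R}_1$, and the inner product $\langle\mathcal{R}_1(f),\mathcal{R}_1(g)\rangle=\langle P_{\mathcal{A}_0\ominus\mathcal{A}_1}f,\,P_{\mathcal{A}_0\ominus\mathcal{A}_1}g\rangle$ on $\mathrm{ran}\,\mathcal{R}_1$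 agrees with the one induced by the kernel $\mathbb{K}^{(\alpha,\beta)}$.
   Context: A function on $\Omega\times\Omega$ is sesqui-analytic if it is holomorphic in the first $m$ variables and anti-holomorphic in the second $m$ variables; $K^t:=\exp(t\log K)$ for the given continuous branch of $\log K$. For a sesqui-analytic non-negative definite kernel $L:\Omega\times\Omega\to\mathcal{M}_k(\mathbb{C})$, $(\mathcal{H},L)$ denotes the reproducing kernel Hilbert space of $\mathbb{C}^k$-valued holomorphic functions on $\Omega$ with $L(\cdot,w)\eta\in(\mathcal{H},L)$ and $\langle f,L(\cdot,w)\eta\rangle=\langle f(w),\eta\rangle_{\mathbb{C}^k}$. The kernel $\mathbb{K}^{(\alpha,\beta)}(z,w):=K^{\alpha+\beta}(z,w)\big((\partial_i\bar\partial_j\log K)(z,w)\big)_{i,j=1}^m$, where $\partial_i=\frac{\partial}{\partial z_i}$, $\bar\partial_j=\frac{\partial}{\partial\bar w_j}$, is $\mathcal{M}_m(\mathbb{C})$-valued and is non-negative definite under the stated hypotheses. The space $(\mathcal{H},K^\alpha)\otimes(\mathcal{H},K^\beta)$ is realized as the reproducing kernel Hilbert space of holomorphic functions $f(z,\zeta)$ on $\Omega\times\Omega$ with kernel $K^\alpha(z,z')K^\beta(\zeta,\zeta')$. For such $f$, $\partial_i f$ ($1\le i\le 2m$) is the derivative with respect to the $i$th of the $2m$ variables $(z,\zeta)$, and $|_\Delta$ denotes restriction to the diagonal $\Delta=\{(z,z):z\in\Omega\}$ (identified with $\Omega$). Further, $\mathcal{A}_0=\{f\in(\mathcal{H},K^\alpha)\otimes(\mathcal{H},K^\beta):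 f_{|\Delta}=0\}$ and $\mathcal{A}_1=\{f\in(\mathcal{H},K^\alpha)\otimes(\mathcal{H},K^\beta): f_{|\Delta}=(\partial_{m+1}f)_{|\Delta}=\cdots=(\partial_{2m}f)_{|\Delta}=0\}$; $\mathcal{A}_0\ominus\mathcal{A}_1=\mathcal{A}_0\cap\mathcal{A}_1^\perp$, and $P_{\mathcal{A}_0\ominus\mathcal{A}_1}$ is the orthogonal projection onto it. (One has $\ker\mathcal{R}_1=(\mathcal{A}_0\ominus\mathcal{A}_1)^\perp$, so the inner product on $\mathrm{ran}\,\mathcal{R}_1$ is well defined.) *)

theory Defs
  imports "HOL-Analysis.Analysis"
begin

section \<open>Functions of several complex variables\<close>

definition holomorphic_vec :: "(complex^'n \<Rightarrow> complex) \<Rightarrow> (complex^'n) set \<Rightarrow> bool" where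
  "holomorphic_vec f S \<longleftrightarrow>
     (\<forall>z\<in>S. \<exists>D. (f has_derivative D) (at z) \<and> (\<forall>c v. D (c *s v) = c * D v))"

definition partial :: "'n \<Rightarrow> (complex^'n \<Rightarrow> complex) \<Rightarrow> complex^'n \<Rightarrow> complex" where
  "partial i f z = deriv (\<lambda>t. f (z + axis i t)) 0"

text \<open>The operator \<open>\<partial>/\<partial>(cnj w\<^sub>j)\<close>.  It is only applied to anti-holomorphic functions, for which
  it is the conjugate of the holomorphic partial derivative of the conjugate function.\<close>

definition partial_bar :: "'n \<Rightarrow> (complex^'n \<Rightarrow> complex) \<Rightarrow> complex^'n \<Rightarrow> complex" where
  "partial_bar j g w = cnj (partial j (\<lambda>v. cnj (g v)) w)"

text \<open>Separate (anti-)holomorphy in the two \<open>m\<close>-tuples of variables; joint regularity then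
  follows from Hartogs, or from Osgood's lemma when \<open>K\<close> is continuous.\<close>

definition sesqui_analytic ::
    "(complex^'n) set \<Rightarrow> (complex^'n \<Rightarrow> complex^'n \<Rightarrow> complex) \<Rightarrow> bool" where
  "sesqui_analytic \<Omega> K \<longleftrightarrow>
     (\<forall>w\<in>\<Omega>. holomorphic_vec (\<lambda>z. K z w) \<Omega>) \<and>
     (\<forall>z\<in>\<Omega>. holomorphic_vec (\<lambda>w. cnj (K z w)) \<Omega>)"

definition continuous_log_branch ::
    "(complex^'n) set \<Rightarrow> (complex^'n \<Rightarrow> complex^'n \<Rightarrow> complex)
      \<Rightarrow> (complex^'n \<Rightarrow> complex^'n \<Rightarrow> complex) \<Rightarrow> bool" where
  "continuous_log_branch \<Omega> K logK \<longleftrightarrow>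
     continuous_on (\<Omega> \<times> \<Omega>) (\<lambda>(z, w). logK z w) \<and>
     (\<forall>z\<in>\<Omega>. \<forall>w\<in>\<Omega>. exp (logK z w) = K z w)"

text \<open>The power \<open>K\<^sup>t = exp (t log K)\<close> determined by the branch \<open>logK\<close>.\<close>

definition kpow :: "('x \<Rightarrow> 'x \<Rightarrow> complex) \<Rightarrow> real \<Rightarrow> 'x \<Rightarrow> 'x \<Rightarrow> complex" where
  "kpow logK t z w = exp (of_real t * logK z w)"

definition nonneg_definite :: "'x set \<Rightarrow> ('x \<Rightarrow> 'x \<Rightarrow> complex) \<Rightarrow> bool" where
  "nonneg_definite X k \<longleftrightarrow>
     (\<forall>S c. finite S \<and> S \<subseteq> X \<longrightarrow>
        (\<Sum>z\<in>S. \<Sum>w\<in>S. cnj (c z) * k z w * c w) \<in> \<real>\<^sub>\<ge>\<^sub>0)"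


section \<open>Reproducing kernel Hilbert spaces\<close>

text \<open>A complex Hilbert space \<open>(H, ip)\<close> of functions on \<open>X\<close>, with \<open>ip\<close> linear in the first argument.
  A function on \<open>X\<close> is represented by the total function that is \<open>0\<close> off \<open>X\<close>.  The parameter
  \<open>sc\<close> is the scalar multiplication of the value space.\<close>

definition hilbert_function_space ::
    "(complex \<Rightarrow> 'v \<Rightarrow> 'v::ab_group_add) \<Rightarrow> 'x set \<Rightarrow> ('x \<Rightarrow> 'v) set
      \<Rightarrow> (('x \<Rightarrow> 'v) \<Rightarrow> ('x \<Rightarrow> 'v) \<Rightarrow> complex) \<Rightarrow> bool" where
  "hilbert_function_space sc X H ip \<longleftrightarrow>
     (\<forall>f\<in>H. \<forall>x. x \<notin> X \<longrightarrow> f x = 0) \<and>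
     (\<lambda>x. 0) \<in> H \<and>
     (\<forall>f\<in>H. \<forall>g\<in>H. (\<lambda>x. f x + g x) \<in> H) \<and>
     (\<forall>c. \<forall>f\<in>H. (\<lambda>x. sc c (f x)) \<in> H) \<and>
     (\<forall>f\<in>H. \<forall>g\<in>H. \<forall>h\<in>H. ip (\<lambda>x. f x + g x) h = ip f h + ip g h) \<and>
     (\<forall>c. \<forall>f\<in>H. \<forall>g\<in>H. ip (\<lambda>x. sc c (f x)) g = c * ip f g) \<and>
     (\<forall>f\<in>H. \<forall>g\<in>H. ip g f = cnj (ip f g)) \<and>
     (\<forall>f\<in>H. ip f f \<in> \<real>\<^sub>\<ge>\<^sub>0 \<and> (ip f f = 0 \<longrightarrow> f = (\<lambda>x. 0))) \<and>
     (\<forall>F :: nat \<Rightarrow> 'x \<Rightarrow> 'v.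
        (\<forall>n. F n \<in> H) \<and>
        (\<forall>e>0. \<exists>N. \<forall>m\<ge>N. \<forall>n\<ge>N.
           sqrt (Re (ip (\<lambda>x. F m x - F n x) (\<lambda>x. F m x - F n x))) < e) \<longrightarrow>
        (\<exists>f\<in>H. (\<lambda>n. sqrt (Re (ip (\<lambda>x. F n x - f x) (\<lambda>x. F n x - f x)))) \<longlonglongrightarrow> 0))"

text \<open>The next two predicates say that \<open>(H, ip)\<close> is the reproducing kernel Hilbert space of
  holomorphic functions on \<open>X\<close> with the given scalar, respectively matrix-valued, kernel.\<close>

definition scalar_rkhs ::
    "(complex^'n) set \<Rightarrow> (complex^'n \<Rightarrow> complex^'n \<Rightarrow> complex) \<Rightarrow> (complex^'n \<Rightarrow> complex) set
      \<Rightarrow> ((complex^'n \<Rightarrow> complex) \<Rightarrow> (complex^'n \<Rightarrow> complex) \<Rightarrow> complex) \<Rightarrow> bool" where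
  "scalar_rkhs X k H ip \<longleftrightarrow>
     hilbert_function_space (*) X H ip \<and>
     (\<forall>f\<in>H. holomorphic_vec f X) \<and>
     (\<forall>w\<in>X. let kw = (\<lambda>z. if z \<in> X then k z w else 0)
             in kw \<in> H \<and> (\<forall>f\<in>H. ip f kw = f w))"

definition matrix_rkhs ::
    "(complex^'n) set \<Rightarrow> (complex^'n \<Rightarrow> complex^'n \<Rightarrow> complex^'k^'k)
      \<Rightarrow> (complex^'n \<Rightarrow> complex^'k) set
      \<Rightarrow> ((complex^'n \<Rightarrow> complex^'k) \<Rightarrow> (complex^'n \<Rightarrow> complex^'k) \<Rightarrow> complex) \<Rightarrow> bool" where
  "matrix_rkhs X L H ip \<longleftrightarrow>
     hilbert_function_space (*s) X H ip \<and>
     (\<forall>f\<in>H. \<forall>i. holomorphic_vec (\<lambda>z. f z $ i) X) \<and>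
     (\<forall>w\<in>X. \<forall>\<eta>. let Lw = (\<lambda>z. if z \<in> X then L z w *v \<eta> else 0)
             in Lw \<in> H \<and> (\<forall>f\<in>H. ip f Lw = (\<Sum>i\<in>UNIV. f w $ i * cnj (\<eta> $ i))))"

definition ortho_diff ::
    "(('x \<Rightarrow> complex) \<Rightarrow> ('x \<Rightarrow> complex) \<Rightarrow> complex) \<Rightarrow> ('x \<Rightarrow> complex) set \<Rightarrow> ('x \<Rightarrow> complex) set
      \<Rightarrow> ('x \<Rightarrow> complex) set" where
  "ortho_diff ip A B = {f\<in>A. \<forall>g\<in>B. ip f g = 0}"

definition ortho_proj ::
    "(('x \<Rightarrow> complex) \<Rightarrow> ('x \<Rightarrow> complex) \<Rightarrow> complex) \<Rightarrow> ('x \<Rightarrow> complex) set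
      \<Rightarrow> ('x \<Rightarrow> complex) \<Rightarrow> ('x \<Rightarrow> complex)" where
  "ortho_proj ip M f = (THE p. p \<in> M \<and> (\<forall>g\<in>M. ip (\<lambda>x. f x - p x) g = 0))"


section \<open>The tensor product space and its diagonal subspaces\<close>

text \<open>Points \<open>(z, \<zeta>)\<close> of \<open>\<complex>\<^sup>m \<times> \<complex>\<^sup>m = \<complex>\<^sup>2\<^sup>m\<close> are vectors indexed by \<open>'m + 'm\<close>:
  \<open>Inl i\<close> is the \<open>i\<close>-th and \<open>Inr i\<close> the \<open>(m + i)\<close>-th variable.\<close>

definition pt :: "complex^'m \<Rightarrow> complex^'m \<Rightarrow> complex^('m + 'm)" where
  "pt z \<zeta> = (\<chi> s. case s of Inl i \<Rightarrow> z $ i | Inr i \<Rightarrow> \<zeta> $ i)"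

definition left_pt :: "complex^('m + 'm) \<Rightarrow> complex^'m" where
  "left_pt x = (\<chi> i. x $ Inl i)"

definition right_pt :: "complex^('m + 'm) \<Rightarrow> complex^'m" where
  "right_pt x = (\<chi> i. x $ Inr i)"

definition square :: "(complex^'m) set \<Rightarrow> (complex^('m + 'm)) set" where
  "square \<Omega> = {pt z \<zeta> | z \<zeta>. z \<in> \<Omega> \<and> \<zeta> \<in> \<Omega>}"

definition tensor_kernel ::
    "(complex^'m \<Rightarrow> complex^'m \<Rightarrow> complex) \<Rightarrow> (complex^'m \<Rightarrow> complex^'m \<Rightarrow> complex)
      \<Rightarrow> complex^('m + 'm) \<Rightarrow> complex^('m + 'm) \<Rightarrow> complex" where
  "tensor_kernel k1 k2 x y = k1 (left_pt x) (left_pt y) * k2 (right_pt x) (right_pt y)"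

definition A0 ::
    "(complex^'m) set \<Rightarrow> (complex^('m + 'm) \<Rightarrow> complex) set \<Rightarrow> (complex^('m + 'm) \<Rightarrow> complex) set" where
  "A0 \<Omega> T = {f\<in>T. \<forall>z\<in>\<Omega>. f (pt z z) = 0}"

definition A1 ::
    "(complex^'m) set \<Rightarrow> (complex^('m + 'm) \<Rightarrow> complex) set \<Rightarrow> (complex^('m + 'm) \<Rightarrow> complex) set" where
  "A1 \<Omega> T = {f\<in>T. \<forall>z\<in>\<Omega>. f (pt z z) = 0 \<and> (\<forall>i. partial (Inr i) f (pt z z) = 0)}"

definition R1 ::
    "(complex^'m) set \<Rightarrow> real \<Rightarrow> real \<Rightarrow> (complex^('m + 'm) \<Rightarrow> complex) \<Rightarrow> complex^'m \<Rightarrow> complex^'m" where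
  "R1 \<Omega> \<alpha> \<beta> f = (\<lambda>z. if z \<in> \<Omega>
     then (\<chi> i. of_real (1 / sqrt (\<alpha> * \<beta> * (\<alpha> + \<beta>))) *
            (of_real \<beta> * partial (Inl i) f (pt z z) - of_real \<alpha> * partial (Inr i) f (pt z z)))
     else 0)"

definition KK ::
    "(complex^'m \<Rightarrow> complex^'m \<Rightarrow> complex) \<Rightarrow> real \<Rightarrow> real
      \<Rightarrow> complex^'m \<Rightarrow> complex^'m \<Rightarrow> complex^'m^'m" where
  "KK logK \<alpha> \<beta> z w = (\<chi> i j. kpow logK (\<alpha> + \<beta>) z w *
      partial i (\<lambda>u. partial_bar j (\<lambda>v. logK u v) w) z)"

end

theory Submission
  imports Defs "HOL-Library.Function_Algebras" "HOL-Complex_Analysis.Cauchy_Integral_Formula"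
begin

text \<open>
  Write \<open>k\<close> for the kernel of the tensor product space \<open>T\<close>, \<open>R\<close> for the operator \<open>R1\<close>, and
  \<open>M\<close> for the orthogonal difference of the diagonal subspaces \<open>A0\<close> and \<open>A1\<close>.  The proof rests
  on the vectors \<open>\<Phi> w j\<close> of \<open>T\<close> that represent the functionals \<open>f \<mapsto> (R f w)\<^sub>j\<close>.  They exist by
  the Riesz theorem: Cauchy's inequality on a small circle bounds a partial derivative by the
  values of \<open>f\<close> there, and these are bounded by the norm of \<open>f\<close> times \<open>k(x,x)\<^sup>1\<^sup>/\<^sup>2\<close>.

  Testing \<open>\<Phi> w j\<close> against the kernel functions of \<open>T\<close> computes it.  The operator differentiates
  \<open>exp (\<alpha> log K + \<beta> log K)\<close> with the weights \<open>\<beta>\<close> and \<open>-\<alpha>\<close> on the two groups of variables, so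
  \<open>\<Phi> w j (z, \<zeta>)\<close> is a constant multiple of \<open>(h z - h \<zeta>) k((z, \<zeta>), (w, w))\<close>, where \<open>h\<close> is the
  \<open>j\<close>-th anti-holomorphic derivative of \<open>log K\<close> in its second argument, taken at \<open>w\<close>
  (lemma \<open>\<Phi>_eq\<close>).  Two consequences decide everything:

  \<^item> The difference vanishes on the diagonal, so \<open>\<Phi> w j\<close> lies in \<open>A0\<close>.  On \<open>A0\<close> the derivatives
    in the two groups of variables are opposite to each other, hence \<open>R\<close> restricted to \<open>A0\<close> is a
    nonzero multiple of the derivatives that cut out \<open>A1\<close>.  So \<open>R\<close> kills \<open>A1\<close>, which says that
    \<open>\<Phi> w j\<close> is orthogonal to \<open>A1\<close>, that is, \<open>\<Phi> w j\<close> lies in \<open>M\<close>; and \<open>R\<close> is injective on \<open>M\<close>.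
    Since the representing vectors lie in \<open>M\<close>, \<open>R\<close> does not see the component of \<open>f\<close> orthogonal
    to \<open>M\<close>.  Therefore \<open>R\<close> maps the Hilbert space \<open>M\<close> bijectively onto the whole range of \<open>R\<close>,
    and transports its inner product to the one in the theorem.

  \<^item> Applying \<open>R\<close> to \<open>\<Phi> w j\<close>, only the derivative of the vanishing difference survives on the
    diagonal, and the result is the \<open>j\<close>-th column of \<open>KK\<close> (lemma \<open>R_\<Phi>\<close>).  Thus the range
    contains the sections of \<open>KK\<close>, and they reproduce because \<open>\<Phi> w j\<close> represents
    \<open>f \<mapsto> (R f w)\<^sub>j\<close>.

  A reproducing kernel determines its Hilbert space (lemma \<open>matrix_rkhs_unique\<close>), so every
  space with kernel \<open>KK\<close> is this range.  The functions in the range are holomorphic because a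
  partial derivative of a holomorphic function of several variables is holomorphic
  (lemma \<open>holomorphic_vec_partial\<close>).
\<close>

section \<open>Hilbert spaces carried by a subset of a vector space\<close>

lemma mult_cnj_self: "z * cnj z = (of_real (cmod z))\<^sup>2"
  by (metis complex_norm_square of_real_power)

text \<open>A Hilbert space whose vectors form a subset of an ambient vector space.  Spaces of functions
  on a fixed set depend on a kernel, so they are sets and not types; the operations are those of
  the ambient function space, and only membership and the inner product vary.\<close>

locale hilbert_set = vector_space scale
  for scale :: "complex \<Rightarrow> 'a::ab_group_add \<Rightarrow> 'a" +
  fixes H :: "'a set" and ip :: "'a \<Rightarrow> 'a \<Rightarrow> complex"
  assumes subspace_H: "subspace H"
    and ip_add_left: "\<lbrakk>f \<in> H; g \<in> H; h \<in> H\<rbrakk> \<Longrightarrow> ip (f + g) h = ip f h + ip g h"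
    and ip_scale_left: "\<And>c f g. \<lbrakk>f \<in> H; g \<in> H\<rbrakk> \<Longrightarrow> ip (scale c f) g = c * ip f g"
    and ip_commute: "\<lbrakk>f \<in> H; g \<in> H\<rbrakk> \<Longrightarrow> ip g f = cnj (ip f g)"
    and ip_nonneg: "f \<in> H \<Longrightarrow> ip f f \<in> \<real>\<^sub>\<ge>\<^sub>0"
    and ip_definite: "\<lbrakk>f \<in> H; ip f f = 0\<rbrakk> \<Longrightarrow> f = 0"
    and complete: "\<lbrakk>\<And>n. F n \<in> H;
        \<And>e. e > 0 \<Longrightarrow> \<exists>N. \<forall>m\<ge>N. \<forall>n\<ge>N. sqrt (Re (ip (F m - F n) (F m - F n))) < e\<rbrakk>
      \<Longrightarrow> \<exists>f\<in>H. (\<lambda>n. sqrt (Re (ip (F n - f) (F n - f)))) \<longlonglongrightarrow> 0"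
begin

definition nrm :: "'a \<Rightarrow> real" where "nrm f = sqrt (Re (ip f f))"

lemmas H_zero [simp] = subspace_0[OF subspace_H]
  and H_add [simp] = subspace_add[OF subspace_H]
  and H_diff [simp] = subspace_diff[OF subspace_H]
  and H_scale [simp] = subspace_scale[OF subspace_H]

lemma ip_add_right: "\<lbrakk>f \<in> H; g \<in> H; h \<in> H\<rbrakk> \<Longrightarrow> ip h (f + g) = ip h f + ip h g"
  by (metis H_add complex_cnj_add ip_add_left ip_commute)

lemma ip_scale_right: "\<lbrakk>f \<in> H; g \<in> H\<rbrakk> \<Longrightarrow> ip f (scale c g) = cnj c * ip f g"
  by (metis H_scale complex_cnj_mult ip_commute ip_scale_left)

lemma ip_diff_left: "\<lbrakk>f \<in> H; g \<in> H; h \<in> H\<rbrakk> \<Longrightarrow> ip (f - g) h = ip f h - ip g h"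
  using ip_add_left[of "f - g" g h] by simp

lemma ip_diff_right: "\<lbrakk>f \<in> H; g \<in> H; h \<in> H\<rbrakk> \<Longrightarrow> ip h (f - g) = ip h f - ip h g"
  using ip_add_right[of "f - g" g h] by simp

lemma ip_zero_left [simp]: "f \<in> H \<Longrightarrow> ip 0 f = 0"
  using ip_diff_left[of f f f] by simp

lemma ip_zero_right [simp]: "f \<in> H \<Longrightarrow> ip f 0 = 0"
  using ip_diff_right[of f f f] by simp

lemma nrm_nonneg [simp]: "f \<in> H \<Longrightarrow> 0 \<le> nrm f"
  using ip_nonneg[of f] by (simp add: nrm_def complex_nonneg_Reals_iff)

lemma ip_self: "f \<in> H \<Longrightarrow> ip f f = of_real ((nrm f)\<^sup>2)"
  using ip_nonneg[of f] by (simp add: nrm_def complex_nonneg_Reals_iff complex_eq_iff)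

lemma nrm_eq_0: "f \<in> H \<Longrightarrow> nrm f = 0 \<longleftrightarrow> f = 0"
  using ip_self[of f] ip_definite[of f] by (auto simp: nrm_def)

lemma nrm_zero [simp]: "nrm 0 = 0"
  by (simp add: nrm_def)

lemma nrm_scale: "f \<in> H \<Longrightarrow> nrm (scale c f) = cmod c * nrm f"
proof -
  assume f: "f \<in> H"
  have "ip (scale c f) (scale c f) = of_real ((cmod c * nrm f)\<^sup>2)"
    using f mult_cnj_self[of c] ip_self[OF f] mult.commute[of "cnj c" c]
    by (simp add: ip_scale_left ip_scale_right power_mult_distrib mult.assoc[symmetric])
  then show ?thesis
    using f by (simp add: nrm_def[of "scale c f"])
qed

lemma nrm_diff_sq:
  assumes "f \<in> H" "g \<in> H"
  shows "(nrm (f - scale c g))\<^sup>2 = (nrm f)\<^sup>2 - 2 * Re (cnj c * ip f g) + (cmod c)\<^sup>2 * (nrm g)\<^sup>2"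
proof -
  have 1: "ip (f - scale c g) (f - scale c g)
      = ip f f - (cnj c * ip f g + cnj (cnj c * ip f g)) + c * cnj c * ip g g"
    using assms ip_commute[of f g]
    by (simp add: ip_diff_left ip_diff_right ip_scale_left ip_scale_right algebra_simps)
  have "of_real ((nrm (f - scale c g))\<^sup>2) =
      complex_of_real ((nrm f)\<^sup>2 - 2 * Re (cnj c * ip f g) + (cmod c)\<^sup>2 * (nrm g)\<^sup>2)"
    using assms 1 mult_cnj_self[of c] unfolding complex_add_cnj
    by (simp add: ip_self)
  then show ?thesis
    by (simp only: of_real_eq_iff)
qed

lemma nrm_commute: "\<lbrakk>f \<in> H; g \<in> H\<rbrakk> \<Longrightarrow> nrm (f - g) = nrm (g - f)"
  using nrm_scale[of "g - f" "-1"] by simp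

text \<open>Subtracting the component of \<open>f\<close> along \<open>g\<close> lowers the squared norm by exactly the
  squared norm of that component.  Nonnegativity of the left-hand side is the Cauchy--Schwarz inequality, and
  minimality of a best approximation turns it into orthogonality.\<close>

lemma projection_decrease:
  assumes "f \<in> H" "g \<in> H" "g \<noteq> 0"
  shows "(nrm (f - scale (ip f g / of_real ((nrm g)\<^sup>2)) g))\<^sup>2
    = (nrm f)\<^sup>2 - (cmod (ip f g))\<^sup>2 / (nrm g)\<^sup>2"
proof -
  have g: "nrm g \<noteq> 0" using assms nrm_eq_0 by blast
  have "cnj (ip f g / of_real ((nrm g)\<^sup>2)) * ip f g = of_real ((cmod (ip f g))\<^sup>2 / (nrm g)\<^sup>2)"
    using mult_cnj_self[of "ip f g"] by (simp add: mult.commute)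
  then have "Re (cnj (ip f g / of_real ((nrm g)\<^sup>2)) * ip f g) = (cmod (ip f g))\<^sup>2 / (nrm g)\<^sup>2"
    by (simp only: Re_complex_of_real)
  moreover have "(cmod (ip f g / of_real ((nrm g)\<^sup>2)))\<^sup>2 * (nrm g)\<^sup>2 = (cmod (ip f g))\<^sup>2 / (nrm g)\<^sup>2"
    using g by (simp add: norm_divide norm_mult norm_power power_divide power2_eq_square)
  ultimately show ?thesis
    unfolding nrm_diff_sq[OF assms(1,2)] by linarith
qed

lemma Cauchy_Schwarz:
  assumes "f \<in> H" "g \<in> H"
  shows "cmod (ip f g) \<le> nrm f * nrm g"
proof (cases "g = 0")
  case False
  then have g: "nrm g \<noteq> 0" using assms nrm_eq_0 by blast
  have "0 \<le> (nrm f)\<^sup>2 - (cmod (ip f g))\<^sup>2 / (nrm g)\<^sup>2"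
    unfolding projection_decrease[OF assms False, symmetric] by simp
  then have "(cmod (ip f g))\<^sup>2 \<le> (nrm f * nrm g)\<^sup>2"
    using g by (simp add: field_simps power_mult_distrib)
  then show ?thesis
    using assms by (simp add: power2_le_iff_abs_le)
qed (use assms in simp)

lemma nrm_triangle:
  assumes "f \<in> H" "g \<in> H"
  shows "nrm (f + g) \<le> nrm f + nrm g"
proof -
  have "(nrm (f + g))\<^sup>2 = (nrm f)\<^sup>2 + 2 * Re (ip f g) + (nrm g)\<^sup>2"
    using nrm_diff_sq[OF assms, of "-1"] by simp
  also have "\<dots> \<le> (nrm f + nrm g)\<^sup>2"
    using Cauchy_Schwarz[OF assms] complex_Re_le_cmod[of "ip f g"] by (simp add: power2_sum)
  finally show ?thesis
    using assms by (simp add: power2_le_iff_abs_le)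
qed

lemma nrm_triangle_diff:
  assumes "f \<in> H" "g \<in> H" "h \<in> H"
  shows "nrm (f - h) \<le> nrm (f - g) + nrm (g - h)"
  using nrm_triangle[of "f - g" "g - h"] assms by simp

lemma parallelogram:
  assumes "f \<in> H" "g \<in> H"
  shows "(nrm (f + g))\<^sup>2 + (nrm (f - g))\<^sup>2 = 2 * (nrm f)\<^sup>2 + 2 * (nrm g)\<^sup>2"
  using nrm_diff_sq[OF assms, of 1] nrm_diff_sq[OF assms, of "-1"] by simp

lemma ip_tendsto:
  assumes F: "\<And>n. F n \<in> H" "f \<in> H" "(\<lambda>n. nrm (F n - f)) \<longlonglongrightarrow> 0" and g: "g \<in> H"
  shows "(\<lambda>n. ip (F n) g) \<longlonglongrightarrow> ip f g"
proof -
  have "(\<lambda>n. ip (F n) g - ip f g) \<longlonglongrightarrow> 0"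
  proof (rule Lim_null_comparison)
    show "\<forall>\<^sub>F n in sequentially. norm (ip (F n) g - ip f g) \<le> nrm (F n - f) * nrm g"
      using F g Cauchy_Schwarz[of "F _ - f" g] by (simp add: ip_diff_left)
    show "(\<lambda>n. nrm (F n - f) * nrm g) \<longlonglongrightarrow> 0"
      using tendsto_mult_left_zero[OF F(3)] .
  qed
  then show ?thesis using Lim_null by blast
qed

definition closed_subspace :: "'a set \<Rightarrow> bool" where
  "closed_subspace M \<longleftrightarrow> subspace M \<and> M \<subseteq> H \<and>
     (\<forall>F f. (\<forall>n. F n \<in> M) \<and> f \<in> H \<and> (\<lambda>n. nrm (F n - f)) \<longlonglongrightarrow> 0 \<longrightarrow> f \<in> M)"

definition orth :: "'a set \<Rightarrow> 'a set" where
  "orth G = {f\<in>H. \<forall>g\<in>G. ip f g = 0}"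

lemma closed_subspace_orth:
  assumes "G \<subseteq> H"
  shows "closed_subspace (orth G)"
  unfolding closed_subspace_def
proof (intro conjI allI impI)
  show "subspace (orth G)"
    by (rule subspaceI) (use assms in \<open>auto simp: orth_def ip_add_left ip_scale_left subset_iff\<close>)
  show "orth G \<subseteq> H" by (auto simp: orth_def)
  fix F f assume a: "(\<forall>n. F n \<in> orth G) \<and> f \<in> H \<and> (\<lambda>n. nrm (F n - f)) \<longlonglongrightarrow> 0"
  have "ip f g = 0" if "g \<in> G" for g
  proof -
    have "(\<lambda>n. ip (F n) g) \<longlonglongrightarrow> ip f g"
      using a that assms by (intro ip_tendsto) (auto simp: orth_def)
    moreover have "(\<lambda>n. ip (F n) g) = (\<lambda>n. 0)"
      using a that by (auto simp: orth_def)
    ultimately show ?thesis by (simp add: LIMSEQ_const_iff)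
  qed
  then show "f \<in> orth G" using a by (auto simp: orth_def)
qed

text \<open>A minimizing sequence for the distance to \<open>M\<close> is Cauchy by the parallelogram law; its limit
  lies in \<open>M\<close>, and no further decrease in a direction of \<open>M\<close> is possible.\<close>

lemma projection_exists:
  assumes M: "closed_subspace M" and f: "f \<in> H"
  shows "\<exists>p\<in>M. \<forall>g\<in>M. ip (f - p) g = 0"
proof -
  have sub: "subspace M" and MH: "g \<in> M \<Longrightarrow> g \<in> H" for g
    using M by (auto simp: closed_subspace_def)
  define D where "D = (\<lambda>g. (nrm (f - g))\<^sup>2) ` M"
  define d where "d = Inf D"
  have D0: "D \<noteq> {}" using subspace_0[OF sub] by (auto simp: D_def)
  have Dbdd: "bdd_below D" by (intro bdd_belowI[of _ 0]) (auto simp: D_def)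
  have d_le: "d \<le> (nrm (f - g))\<^sup>2" if "g \<in> M" for g
    unfolding d_def using that Dbdd by (intro cInf_lower) (auto simp: D_def)
  have "\<exists>g\<in>M. (nrm (f - g))\<^sup>2 < d + 1 / real (Suc n)" for n
  proof -
    have "Inf D < d + 1 / real (Suc n)" by (simp add: d_def)
    from cInf_lessD[OF D0 this] show ?thesis by (auto simp: D_def)
  qed
  then obtain F where F: "\<And>n. F n \<in> M" "\<And>n. (nrm (f - F n))\<^sup>2 < d + 1 / real (Suc n)"
    by metis
  note FH = MH[OF F(1)]
  have cauchy: "(nrm (F m - F n))\<^sup>2 \<le> 2 / real (Suc m) + 2 / real (Suc n)" for m n
  proof -
    \<comment> \<open>The midpoint belongs to \<open>M\<close>, so its squared distance to \<open>f\<close> is at least \<open>d\<close>.\<close>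
    define h where "h = scale (1/2) (F m + F n)"
    have h: "h \<in> M" using F(1) sub by (simp add: h_def subspace_add subspace_scale)
    have "(f - F m) + (f - F n) = scale 2 (f - h)"
      by (simp add: h_def scale_right_diff_distrib scale_right_distrib)
         (metis (no_types, lifting) add_diff_add one_add_one scale_left_distrib scale_one)
    then have "(nrm ((f - F m) + (f - F n)))\<^sup>2 = 4 * (nrm (f - h))\<^sup>2"
      using f MH[OF h] by (simp add: nrm_scale power_mult_distrib)
    moreover have "nrm ((f - F m) - (f - F n)) = nrm (F m - F n)"
      using nrm_commute[OF FH FH, of m n] by simp
    ultimately have "4 * (nrm (f - h))\<^sup>2 + (nrm (F m - F n))\<^sup>2
        = 2 * (nrm (f - F m))\<^sup>2 + 2 * (nrm (f - F n))\<^sup>2"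
      using parallelogram[of "f - F m" "f - F n"] f FH by simp
    then show ?thesis
      using d_le[OF h] F(2)[of m] F(2)[of n] by linarith
  qed
  have "\<exists>p\<in>H. (\<lambda>n. nrm (F n - p)) \<longlonglongrightarrow> 0"
    unfolding nrm_def
  proof (rule complete)
    fix e :: real assume "e > 0"
    then obtain N where N: "4 / e\<^sup>2 < real N" using reals_Archimedean2 by blast
    have "sqrt (Re (ip (F m - F n) (F m - F n))) < e" if "m \<ge> N" "n \<ge> N" for m n
    proof -
      have "2 / real (Suc k) < e\<^sup>2 / 2" if "k \<ge> N" for k
      proof -
        have "4 / e\<^sup>2 < real (Suc k)" using N that by linarith
        then show ?thesis using \<open>e > 0\<close> by (simp add: field_simps)
      qed
      from this[OF that(1)] this[OF that(2)] have "(nrm (F m - F n))\<^sup>2 < e\<^sup>2"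
        using cauchy[of m n] by linarith
      then show ?thesis
        using \<open>e > 0\<close> unfolding nrm_def by (meson less_imp_le power_less_imp_less_base)
    qed
    then show "\<exists>N. \<forall>m\<ge>N. \<forall>n\<ge>N. sqrt (Re (ip (F m - F n) (F m - F n))) < e" by blast
  qed (rule FH)
  then obtain p where p: "p \<in> H" "(\<lambda>n. nrm (F n - p)) \<longlonglongrightarrow> 0" by blast
  have pM: "p \<in> M" using M F(1) p by (auto simp: closed_subspace_def)
  have "nrm (f - p) \<le> sqrt d"
  proof (rule LIMSEQ_le_const)
    have "(\<lambda>n. sqrt (d + 1 / real (Suc n)) + nrm (F n - p)) \<longlonglongrightarrow> sqrt (d + 0) + 0"
      by (intro tendsto_intros p(2) LIMSEQ_Suc[OF lim_1_over_n])
    then show "(\<lambda>n. sqrt (d + 1 / real (Suc n)) + nrm (F n - p)) \<longlonglongrightarrow> sqrt d" by simp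
    have "nrm (f - p) \<le> sqrt (d + 1 / real (Suc n)) + nrm (F n - p)" for n
      using nrm_triangle_diff[OF f FH p(1), of n] real_le_rsqrt[of "nrm (f - F n)" "d + 1 / real (Suc n)"] F(2)[of n]
      by linarith
    then show "\<exists>N. \<forall>n\<ge>N. nrm (f - p) \<le> sqrt (d + 1 / real (Suc n)) + nrm (F n - p)" by blast
  qed
  moreover have "0 \<le> d" unfolding d_def using D0 by (intro cInf_greatest) (auto simp: D_def)
  ultimately have pd: "(nrm (f - p))\<^sup>2 \<le> d"
    using power_mono[of "nrm (f - p)" "sqrt d" 2] f p(1) by simp
  have "ip (f - p) g = 0" if g: "g \<in> M" for g
  proof (cases "g = 0")
    case True then show ?thesis using f p(1) by simp
  next
    case False
    let ?c = "ip (f - p) g / of_real ((nrm g)\<^sup>2)"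
    have "p + scale ?c g \<in> M" using pM g sub by (simp add: subspace_add subspace_scale)
    from d_le[OF this] have "d \<le> (nrm (f - p - scale ?c g))\<^sup>2" by (simp add: diff_diff_add)
    also have "\<dots> = (nrm (f - p))\<^sup>2 - (cmod (ip (f - p) g))\<^sup>2 / (nrm g)\<^sup>2"
      using False f p(1) MH[OF g] by (intro projection_decrease) auto
    finally have "(cmod (ip (f - p) g))\<^sup>2 / (nrm g)\<^sup>2 \<le> 0" using pd by linarith
    moreover have "nrm g \<noteq> 0" using False MH[OF g] nrm_eq_0 by blast
    ultimately show ?thesis by (simp add: divide_le_0_iff not_less)
  qed
  with pM show ?thesis by blast
qed

lemma projection_unique:
  assumes M: "subspace M" "M \<subseteq> H" and f: "f \<in> H"
    and p: "p \<in> M" "\<forall>g\<in>M. ip (f - p) g = 0" and p': "p' \<in> M" "\<forall>g\<in>M. ip (f - p') g = 0"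
  shows "p = p'"
proof -
  have m: "p - p' \<in> M" using M p p' by (simp add: subspace_diff)
  have H: "p \<in> H" "p' \<in> H" using M p p' by auto
  have "ip (f - p') (p - p') - ip (f - p) (p - p') = 0"
    using p(2) p'(2) m by simp
  then have "ip (p - p') (p - p') = 0"
    using H f by (simp add: ip_diff_left)
  then show ?thesis using ip_definite[of "p - p'"] H by simp
qed

text \<open>The projection of a vector onto the kernel of the functional leaves a vector \<open>u\<close> orthogonal
  to the kernel, and the representing vector is a multiple of \<open>u\<close>.\<close>

lemma Riesz:
  assumes add: "\<And>f g. \<lbrakk>f \<in> H; g \<in> H\<rbrakk> \<Longrightarrow> \<phi> (f + g) = \<phi> f + \<phi> g"
    and hom: "\<And>c f. f \<in> H \<Longrightarrow> \<phi> (scale c f) = c * \<phi> f"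
    and bdd: "\<And>f. f \<in> H \<Longrightarrow> cmod (\<phi> f) \<le> C * nrm f"
  shows "\<exists>r\<in>H. \<forall>f\<in>H. \<phi> f = ip f r"
proof (cases "\<forall>f\<in>H. \<phi> f = 0")
  case True then show ?thesis by (intro bexI[of _ 0]) auto
next
  case False
  then obtain f where f: "f \<in> H" "\<phi> f \<noteq> 0" by blast
  define N where "N = {f\<in>H. \<phi> f = 0}"
  have diff: "\<phi> (f - g) = \<phi> f - \<phi> g" if "f \<in> H" "g \<in> H" for f g
    using add[of "f - g" g] that by simp
  have zero: "\<phi> 0 = 0" using hom[of 0 0] by simp
  have "closed_subspace N"
    unfolding closed_subspace_def
  proof (intro conjI allI impI)
    show "subspace N" by (rule subspaceI) (auto simp: N_def add hom zero)
    show "N \<subseteq> H" by (auto simp: N_def)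
    fix F f assume a: "(\<forall>n. F n \<in> N) \<and> f \<in> H \<and> (\<lambda>n. nrm (F n - f)) \<longlonglongrightarrow> 0"
    have "cmod (\<phi> f) \<le> C * nrm (F n - f)" for n
      using bdd[of "F n - f"] diff[of "F n" f] a by (auto simp: N_def)
    moreover have "(\<lambda>n. C * nrm (F n - f)) \<longlonglongrightarrow> 0"
      using a tendsto_mult_right_zero by blast
    ultimately have "cmod (\<phi> f) \<le> 0" by (intro LIMSEQ_le_const) auto
    then show "f \<in> N" using a by (simp add: N_def)
  qed
  from projection_exists[OF this f(1)] obtain p
    where p: "p \<in> N" "\<forall>g\<in>N. ip (f - p) g = 0" by blast
  define u where "u = f - p"
  have u: "u \<in> H" "\<phi> u \<noteq> 0" using f p diff[of f p] by (auto simp: u_def N_def)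
  then have "u \<noteq> 0" using zero by auto
  then have nu: "nrm u \<noteq> 0" using nrm_eq_0 u by blast
  \<comment> \<open>The functional kills \<open>\<phi> u g - \<phi> g u\<close>, which is therefore orthogonal to \<open>u\<close>.\<close>
  have "\<phi> g = ip g (scale (cnj (\<phi> u / of_real ((nrm u)\<^sup>2))) u)" if g: "g \<in> H" for g
  proof -
    have "scale (\<phi> u) g - scale (\<phi> g) u \<in> N"
      using u g by (simp add: N_def diff hom)
    then have "ip (scale (\<phi> u) g - scale (\<phi> g) u) u = 0"
      using p(2) u g ip_commute[of u "scale (\<phi> u) g - scale (\<phi> g) u"]
      unfolding u_def[symmetric] by simp
    then have "\<phi> u * ip g u = \<phi> g * of_real ((nrm u)\<^sup>2)"
      using u g by (simp add: ip_diff_left ip_scale_left ip_self)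
    then show ?thesis using nu u g by (simp add: ip_scale_right field_simps)
  qed
  moreover have "scale (cnj (\<phi> u / of_real ((nrm u)\<^sup>2))) u \<in> H" using u by simp
  ultimately show ?thesis by blast
qed

lemma hilbert_set_closed_subspace:
  assumes M: "closed_subspace M"
  shows "hilbert_set scale M ip"
proof unfold_locales
  have MH: "g \<in> M \<Longrightarrow> g \<in> H" for g using M by (auto simp: closed_subspace_def)
  show "subspace M" using M by (simp add: closed_subspace_def)
  fix f g h c
  show "f \<in> M \<Longrightarrow> g \<in> M \<Longrightarrow> h \<in> M \<Longrightarrow> ip (f + g) h = ip f h + ip g h"
    and "f \<in> M \<Longrightarrow> g \<in> M \<Longrightarrow> ip (scale c f) g = c * ip f g"
    and "f \<in> M \<Longrightarrow> g \<in> M \<Longrightarrow> ip g f = cnj (ip f g)"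
    and "f \<in> M \<Longrightarrow> ip f f \<in> \<real>\<^sub>\<ge>\<^sub>0"
    and "f \<in> M \<Longrightarrow> ip f f = 0 \<Longrightarrow> f = 0"
    by (auto dest!: MH simp: ip_add_left ip_scale_left ip_nonneg ip_definite intro: ip_commute)
next
  fix F :: "nat \<Rightarrow> 'a" assume a: "\<And>n. F n \<in> M"
    "\<And>e. e > 0 \<Longrightarrow> \<exists>N. \<forall>m\<ge>N. \<forall>n\<ge>N. sqrt (Re (ip (F m - F n) (F m - F n))) < e"
  have FH: "F n \<in> H" for n using a(1)[of n] M by (auto simp: closed_subspace_def)
  have "\<exists>f\<in>H. (\<lambda>n. sqrt (Re (ip (F n - f) (F n - f)))) \<longlonglongrightarrow> 0"
    by (rule complete) (use FH a(2) in auto)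
  then obtain f where "f \<in> H" "(\<lambda>n. nrm (F n - f)) \<longlonglongrightarrow> 0"
    unfolding nrm_def by auto
  moreover from this have "f \<in> M" using M a(1) by (auto simp: closed_subspace_def)
  ultimately show "\<exists>f\<in>M. (\<lambda>n. sqrt (Re (ip (F n - f) (F n - f)))) \<longlonglongrightarrow> 0"
    unfolding nrm_def by blast
qed

text \<open>The closure of the span is a closed subspace, and the component of \<open>f\<close> orthogonal to it is
  zero by totality.\<close>

lemma span_dense:
  assumes G: "G \<subseteq> H" and total: "\<And>f. f \<in> H \<Longrightarrow> (\<forall>g\<in>G. ip f g = 0) \<Longrightarrow> f = 0"
    and f: "f \<in> H"
  shows "\<exists>F. (\<forall>n. F n \<in> span G) \<and> (\<lambda>n. nrm (F n - f)) \<longlonglongrightarrow> 0"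
proof -
  have SH: "g \<in> H" if "g \<in> span G" for g
    using that span_minimal[OF G subspace_H] by blast
  define C where "C = {f\<in>H. \<forall>e>0. \<exists>g\<in>span G. nrm (g - f) < e}"
  have "closed_subspace C"
    unfolding closed_subspace_def
  proof (intro conjI allI impI)
    show "subspace C"
    proof (rule subspaceI)
      show "0 \<in> C" using span_zero by (force simp: C_def)
    next
      fix x y assume x: "x \<in> C" and y: "y \<in> C"
      have "\<exists>g\<in>span G. nrm (g - (x + y)) < e" if "e > 0" for e
      proof -
        have e2: "e/2 > 0" using \<open>e > 0\<close> by simp
        obtain g where g: "g \<in> span G" "nrm (g - x) < e/2"
          using x e2 unfolding C_def by blast
        obtain h where h: "h \<in> span G" "nrm (h - y) < e/2"
          using y e2 unfolding C_def by blast
        have "nrm ((g - x) + (h - y)) < e"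
          using nrm_triangle[of "g - x" "h - y"] g h x y SH by (simp add: C_def)
        then show ?thesis using g h by (intro bexI[of _ "g + h"]) (auto simp: span_add algebra_simps)
      qed
      then show "x + y \<in> C" using x y by (simp add: C_def)
    next
      fix c x assume x: "x \<in> C"
      have "\<exists>g\<in>span G. nrm (g - scale c x) < e" if "e > 0" for e
      proof -
        have "e / (cmod c + 1) > 0" using \<open>e > 0\<close> by (simp add: add_nonneg_pos)
        then obtain g where g: "g \<in> span G" "nrm (g - x) < e / (cmod c + 1)"
          using x unfolding C_def by blast
        have xH: "x \<in> H" using x by (simp add: C_def)
        have "nrm (scale c g - scale c x) = cmod c * nrm (g - x)"
          using SH[OF g(1)] xH by (simp add: scale_right_diff_distrib[symmetric] nrm_scale)
        also have "\<dots> \<le> (cmod c + 1) * nrm (g - x)"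
          using SH[OF g(1)] xH by (intro mult_right_mono) auto
        also have "\<dots> < e" using g(2) by (simp add: pos_less_divide_eq add_nonneg_pos mult.commute)
        finally show ?thesis using g by (auto simp: span_scale)
      qed
      then show "scale c x \<in> C" using x by (simp add: C_def)
    qed
    show "C \<subseteq> H" by (auto simp: C_def)
    fix F f assume a: "(\<forall>n. F n \<in> C) \<and> f \<in> H \<and> (\<lambda>n. nrm (F n - f)) \<longlonglongrightarrow> 0"
    have "\<exists>g\<in>span G. nrm (g - f) < e" if "e > 0" for e
    proof -
      have "\<forall>\<^sub>F n in sequentially. nrm (F n - f) < e/2"
        using a \<open>e > 0\<close> by (intro order_tendstoD(2)[of _ 0]) auto
      then obtain n where n: "nrm (F n - f) < e/2" by (auto simp: eventually_sequentially)
      have "e/2 > 0" "F n \<in> C" using \<open>e > 0\<close> a by simp_all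
      then obtain g where g: "g \<in> span G" "nrm (g - F n) < e/2"
        unfolding C_def by blast
      have "nrm (g - f) < e"
        using nrm_triangle_diff[of g "F n" f] n g SH a by (auto simp: C_def)
      then show ?thesis using g by blast
    qed
    then show "f \<in> C" using a by (simp add: C_def)
  qed
  from projection_exists[OF this f] obtain p where p: "p \<in> C" "\<forall>g\<in>C. ip (f - p) g = 0" by blast
  have "G \<subseteq> C" using G by (force simp: C_def intro: span_base)
  moreover have "p \<in> H" using p by (simp add: C_def)
  ultimately have "f - p = 0" using p f by (intro total) auto
  with p have "f \<in> C" by simp
  have "\<exists>g\<in>span G. nrm (g - f) < inverse (real (Suc n))" for n
    using \<open>f \<in> C\<close> by (simp add: C_def del: of_nat_Suc)
  then obtain F where F: "\<And>n. F n \<in> span G" "\<And>n. nrm (F n - f) < inverse (real (Suc n))"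
    by metis
  have "(\<lambda>n. nrm (F n - f)) \<longlonglongrightarrow> 0"
  proof (rule Lim_null_comparison)
    show "\<forall>\<^sub>F n in sequentially. norm (nrm (F n - f)) \<le> inverse (real (Suc n))"
      using F f SH by (auto intro!: always_eventually simp: less_imp_le simp del: of_nat_Suc)
  qed (rule LIMSEQ_inverse_real_of_nat)
  with F(1) show ?thesis by blast
qed

lemma Cauchy_of_convergent:
  assumes F: "\<And>n. F n \<in> H" "f \<in> H" "(\<lambda>n. nrm (F n - f)) \<longlonglongrightarrow> 0" and "e > 0"
  shows "\<exists>N. \<forall>m\<ge>N. \<forall>n\<ge>N. nrm (F m - F n) < e"
proof -
  have "\<forall>\<^sub>F n in sequentially. nrm (F n - f) < e/2"
    using F \<open>e > 0\<close> by (intro order_tendstoD(2)[of _ 0]) auto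
  then obtain N where N: "\<And>n. n \<ge> N \<Longrightarrow> nrm (F n - f) < e/2" by (auto simp: eventually_sequentially)
  have "nrm (F m - F n) < e" if "m \<ge> N" "n \<ge> N" for m n
    using nrm_triangle_diff[of "F m" f "F n"] N[OF that(1)] N[OF that(2)] F nrm_commute[of f "F n"]
    by simp
  then show ?thesis by blast
qed

end

text \<open>Here \<open>G\<close> plays the part of the kernel sections.  The two norms coincide on the span of \<open>G\<close>,
  so a sequence from the span that converges to \<open>f\<close> in the first space is Cauchy in the second;
  the hypothesis \<open>sep\<close>, which for function spaces says that inner products with sections are point
  values, identifies the two limits.\<close>

lemma rkhs_subset:
  fixes scale :: "complex \<Rightarrow> 'a::ab_group_add \<Rightarrow> 'a"
  assumes H1: "hilbert_set scale H1 ip1" and H2: "hilbert_set scale H2 ip2"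
    and G: "G \<subseteq> H1" "G \<subseteq> H2"
    and agree: "\<And>f g. \<lbrakk>f \<in> H1; f \<in> H2; g \<in> G\<rbrakk> \<Longrightarrow> ip1 f g = ip2 f g"
    and sep: "\<And>f f'. \<lbrakk>f \<in> H1; f' \<in> H2; \<And>g. g \<in> G \<Longrightarrow> ip1 f g = ip2 f' g\<rbrakk> \<Longrightarrow> f = f'"
    and f: "f \<in> H1"
  shows "f \<in> H2" and "h \<in> H1 \<Longrightarrow> h \<in> H2 \<Longrightarrow> ip1 f h = ip2 f h"
proof -
  interpret A: hilbert_set scale H1 ip1 by fact
  interpret B: hilbert_set scale H2 ip2 by fact
  have S1: "g \<in> H1" if "g \<in> A.span G" for g
    using that A.span_minimal[OF G(1) A.subspace_H] by blast
  have S2: "g \<in> H2" if "g \<in> A.span G" for g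
    using that A.span_minimal[OF G(2) B.subspace_H] by blast
  have eG: "ip1 f g = ip2 f g" if f: "f \<in> H1" "f \<in> H2" and g: "g \<in> A.span G" for f g
  proof -
    from g have "g \<in> H1 \<and> g \<in> H2 \<and> ip1 f g = ip2 f g"
    proof (induction rule: A.span_induct_alt)
      case base then show ?case using f by simp
    next
      case (step c x y)
      then show ?case
        using f agree[OF f step(1)] G
        by (auto simp: A.ip_add_right A.ip_scale_right B.ip_add_right B.ip_scale_right subset_iff)
    qed
    then show ?thesis by simp
  qed
  have nS: "A.nrm g = B.nrm g" if "g \<in> A.span G" for g
    using eG[OF S1[OF that] S2[OF that] that] by (simp add: A.nrm_def B.nrm_def)
  have tot: "x = 0" if "x \<in> H1" "\<forall>g\<in>G. ip1 x g = 0" for x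
  proof (rule sep)
    fix g assume g: "g \<in> G"
    have "ip2 0 g = 0" using g G by auto
    then show "ip1 x g = ip2 0 g" using that g by simp
  qed (use that in auto)
  have key: "\<exists>F. (\<forall>n. F n \<in> A.span G) \<and> (\<lambda>n. A.nrm (F n - f)) \<longlonglongrightarrow> 0 \<and>
      f \<in> H2 \<and> (\<lambda>n. B.nrm (F n - f)) \<longlonglongrightarrow> 0" if f: "f \<in> H1" for f
  proof -
    obtain F where F: "\<And>n. F n \<in> A.span G" "(\<lambda>n. A.nrm (F n - f)) \<longlonglongrightarrow> 0"
      using A.span_dense[OF G(1) tot f] by blast
    have "\<exists>f'\<in>H2. (\<lambda>n. B.nrm (F n - f')) \<longlonglongrightarrow> 0"
      unfolding B.nrm_def
    proof (rule B.complete)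
      show "F n \<in> H2" for n using F S2 by blast
      fix e :: real assume "e > 0"
      show "\<exists>N. \<forall>m\<ge>N. \<forall>n\<ge>N. sqrt (Re (ip2 (F m - F n) (F m - F n))) < e"
        using A.Cauchy_of_convergent[OF S1[OF F(1)] f F(2) \<open>e > 0\<close>]
        unfolding nS[OF A.span_diff[OF F(1) F(1)]] B.nrm_def .
    qed
    then obtain f' where f': "f' \<in> H2" "(\<lambda>n. B.nrm (F n - f')) \<longlonglongrightarrow> 0" by blast
    have "f = f'"
    proof (rule sep)
      fix g assume g: "g \<in> G"
      have "(\<lambda>n. ip1 (F n) g) \<longlonglongrightarrow> ip1 f g"
        by (rule A.ip_tendsto[OF S1[OF F(1)] f F(2)]) (use g G in auto)
      moreover have "(\<lambda>n. ip2 (F n) g) \<longlonglongrightarrow> ip2 f' g"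
        by (rule B.ip_tendsto[OF S2[OF F(1)] f']) (use g G in auto)
      moreover have "ip1 (F n) g = ip2 (F n) g" for n
        by (rule eG) (use g F(1) S1 S2 in \<open>auto intro: A.span_base\<close>)
      ultimately show "ip1 f g = ip2 f' g" using LIMSEQ_unique by simp
    qed (use f f' in auto)
    then show ?thesis using F f' by blast
  qed
  then show fH2: "f \<in> H2" using f by blast
  assume h: "h \<in> H1" "h \<in> H2"
  obtain F where F: "\<And>n. F n \<in> A.span G" "(\<lambda>n. A.nrm (F n - h)) \<longlonglongrightarrow> 0" "(\<lambda>n. B.nrm (F n - h)) \<longlonglongrightarrow> 0"
    using key[OF h(1)] by blast
  have "(\<lambda>n. ip1 (F n) f) \<longlonglongrightarrow> ip1 h f"
    by (rule A.ip_tendsto[OF S1[OF F(1)] h(1) F(2) f])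
  moreover have "(\<lambda>n. ip2 (F n) f) \<longlonglongrightarrow> ip2 h f"
    by (rule B.ip_tendsto[OF S2[OF F(1)] h(2) F(3) fH2])
  moreover have "ip1 (F n) f = ip2 (F n) f" for n
    using eG[OF f fH2 F(1)[of n]] A.ip_commute[of f "F n"] B.ip_commute[of f "F n"] f fH2 S1[OF F(1)] S2[OF F(1)]
    by simp
  ultimately have "ip1 h f = ip2 h f" using LIMSEQ_unique by simp
  then show "ip1 f h = ip2 f h"
    using A.ip_commute[of h f] B.ip_commute[of h f] f fH2 h by simp
qed

lemma rkhs_unique:
  fixes scale :: "complex \<Rightarrow> 'a::ab_group_add \<Rightarrow> 'a"
  assumes "hilbert_set scale H1 ip1" "hilbert_set scale H2 ip2"
    and "G \<subseteq> H1" "G \<subseteq> H2"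
    and agree: "\<And>f g. \<lbrakk>f \<in> H1; f \<in> H2; g \<in> G\<rbrakk> \<Longrightarrow> ip1 f g = ip2 f g"
    and sep: "\<And>f f'. \<lbrakk>f \<in> H1; f' \<in> H2; \<And>g. g \<in> G \<Longrightarrow> ip1 f g = ip2 f' g\<rbrakk> \<Longrightarrow> f = f'"
  shows "H1 = H2 \<and> (\<forall>f\<in>H1. \<forall>g\<in>H1. ip1 f g = ip2 f g)"
proof -
  have 1: "f \<in> H2" if "f \<in> H1" for f
    by (rule rkhs_subset(1)[OF assms that])
  have 2: "f \<in> H1" if "f \<in> H2" for f
  proof (rule rkhs_subset(1)[OF assms(2,1,4,3) _ _ that])
    show "ip2 f g = ip1 f g" if "f \<in> H2" "f \<in> H1" "g \<in> G" for f g
      using agree that by simp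
    show "f = f'" if "f \<in> H2" "f' \<in> H1" "\<And>g. g \<in> G \<Longrightarrow> ip2 f g = ip1 f' g" for f f'
      using sep[of f' f] that by simp
  qed
  have "ip1 f g = ip2 f g" if "f \<in> H1" "g \<in> H1" for f g
    by (rule rkhs_subset(2)[OF assms that(1) that(2) 1[OF that(2)]])
  with 1 2 show ?thesis by blast
qed

lemma (in hilbert_set) hilbert_set_image:
  fixes scale' :: "complex \<Rightarrow> 'b::ab_group_add \<Rightarrow> 'b" and R :: "'a \<Rightarrow> 'b"
  assumes v: "vector_space scale'"
    and add: "\<And>f g. \<lbrakk>f \<in> H; g \<in> H\<rbrakk> \<Longrightarrow> R (f + g) = R f + R g"
    and hom: "\<And>c f. f \<in> H \<Longrightarrow> R (scale c f) = scale' c (R f)"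
    and inj: "inj_on R H"
  shows "hilbert_set scale' (R ` H) (\<lambda>F G. ip (the_inv_into H R F) (the_inv_into H R G))"
proof -
  interpret V: vector_space scale' by fact
  define J where "J = the_inv_into H R"
  have J: "J (R f) = f" if "f \<in> H" for f
    using that inj by (simp add: J_def the_inv_into_f_f)
  note add' = add[symmetric] and hom' = hom[symmetric]
  have diff': "R f - R g = R (f - g)" if "f \<in> H" "g \<in> H" for f g
    using add[of "f - g" g] that by simp
  have zero: "R 0 = 0" using hom[of 0 0] by simp
  have "hilbert_set scale' (R ` H) (\<lambda>F G. ip (J F) (J G))"
  proof unfold_locales
    show "V.subspace (R ` H)"
    proof (rule V.subspaceI)
      show "0 \<in> R ` H" using zero H_zero by (metis imageI)
    qed (auto simp: add' hom')
    fix f g h c assume f: "f \<in> R ` H"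
    show "g \<in> R ` H \<Longrightarrow> h \<in> R ` H \<Longrightarrow> ip (J (f + g)) (J h) = ip (J f) (J h) + ip (J g) (J h)"
      using f by (auto simp: J add' ip_add_left)
    show "g \<in> R ` H \<Longrightarrow> ip (J (scale' c f)) (J g) = c * ip (J f) (J g)"
      using f by (auto simp: J hom' ip_scale_left)
    show "g \<in> R ` H \<Longrightarrow> ip (J g) (J f) = cnj (ip (J f) (J g))"
      using f by (auto simp: J intro: ip_commute)
    show "ip (J f) (J f) \<in> \<real>\<^sub>\<ge>\<^sub>0" using f by (auto simp: J ip_nonneg)
    show "ip (J f) (J f) = 0 \<Longrightarrow> f = 0" using f ip_definite zero by (force simp: J)
  next
    fix F :: "nat \<Rightarrow> 'b" assume a: "\<And>n. F n \<in> R ` H"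
      "\<And>e. e > 0 \<Longrightarrow> \<exists>N. \<forall>m\<ge>N. \<forall>n\<ge>N. sqrt (Re (ip (J (F m - F n)) (J (F m - F n)))) < e"
    then have "\<forall>n. \<exists>g\<in>H. F n = R g" by blast
    then obtain g where g: "\<And>n. g n \<in> H" and F: "F = (\<lambda>n. R (g n))" by metis
    have "\<exists>N. \<forall>m\<ge>N. \<forall>n\<ge>N. sqrt (Re (ip (g m - g n) (g m - g n))) < e" if "e > 0" for e
      using a(2)[OF that] g by (simp add: F diff' J)
    from complete[OF g this] obtain f
      where "f \<in> H" "(\<lambda>n. sqrt (Re (ip (g n - f) (g n - f)))) \<longlonglongrightarrow> 0" by blast
    then show "\<exists>f\<in>R ` H. (\<lambda>n. sqrt (Re (ip (J (F n - f)) (J (F n - f))))) \<longlonglongrightarrow> 0"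
      using g by (intro bexI[of _ "R f"]) (auto simp: F diff' J)
  qed
  then show ?thesis by (simp only: J_def)
qed

lemma vector_space_fun:
  assumes "vector_space sc"
  shows "vector_space (\<lambda>c (f :: 'x \<Rightarrow> 'v::ab_group_add) x. sc c (f x))"
proof -
  interpret vector_space sc by fact
  show ?thesis
    by unfold_locales (auto simp: fun_eq_iff scale_right_distrib scale_left_distrib)
qed

text \<open>The defining clauses of a Hilbert function space are those of \<open>hilbert_set\<close> for the pointwise
  operations, so that the abstract results apply to them.\<close>

lemma hilbert_function_space_iff:
  fixes sc :: "complex \<Rightarrow> 'v::ab_group_add \<Rightarrow> 'v" and X :: "'x set"
  assumes "vector_space sc"
  shows "hilbert_function_space sc X H ip \<longleftrightarrow>
    hilbert_set (\<lambda>c f x. sc c (f x)) H ip \<and> (\<forall>f\<in>H. \<forall>x. x \<notin> X \<longrightarrow> f x = 0)"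
proof -
  interpret F: vector_space "\<lambda>c (f :: 'x \<Rightarrow> 'v) x. sc c (f x)"
    by (rule vector_space_fun) fact
  have eqs: "(\<lambda>x. f x + g x) = f + g" "(\<lambda>x. f x - g x) = f - g" "(\<lambda>x. 0) = (0 :: 'x \<Rightarrow> 'v)"
    for f g :: "'x \<Rightarrow> 'v" by (auto simp: fun_eq_iff)
  show ?thesis
    unfolding hilbert_function_space_def hilbert_set_def hilbert_set_axioms_def F.subspace_def eqs
    by (simp only: F.vector_space_axioms Ball_def imp_conjL imp_conjR all_conj_distrib all_simps)
      (rule iffI; elim conjE; intro conjI; (rule TrueI)?; assumption)
qed

section \<open>Holomorphic functions of several variables\<close>

lemma norm_scalar_mult: "norm (c *s v) = cmod c * norm (v :: complex^'n)"
proof -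
  have "norm (c *s v) = L2_set (\<lambda>i. cmod c * norm (v $ i)) UNIV"
    by (simp add: norm_vec_def norm_mult)
  also have "\<dots> = cmod c * norm v"
    by (simp add: L2_set_right_distrib norm_vec_def)
  finally show ?thesis .
qed

lemma bounded_linear_scalar_mult: "bounded_linear (\<lambda>c. c *s (v :: complex^'n))"
  unfolding linear_conv_bounded_linear[symmetric]
  by (rule linearI) (simp_all add: vec_eq_iff algebra_simps)

lemma axis_scalar: "axis i t = t *s (axis i 1 :: complex^'n)"
  by (simp add: vec_eq_iff axis_def)

lemma axis_zero: "axis i 0 = (0 :: complex^'n)"
  by (simp add: axis_eq_0_iff)

lemma has_field_derivative_along_line:
  fixes f :: "complex^'n \<Rightarrow> complex"
  assumes f: "(f has_derivative D) (at (z + t *s h))" and D: "\<And>c v. D (c *s v) = c * D v"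
  shows "((\<lambda>s. f (z + s *s h)) has_field_derivative D h) (at t)"
proof -
  have "((\<lambda>s. z + s *s h) has_derivative (\<lambda>s. s *s h)) (at t)"
    using has_derivative_add[OF has_derivative_const bounded_linear_imp_has_derivative[OF bounded_linear_scalar_mult]]
    by simp
  from diff_chain_at[OF this f] have "((\<lambda>s. f (z + s *s h)) has_derivative (\<lambda>s. s * D h)) (at t)"
    by (simp add: o_def D)
  moreover have "(\<lambda>s. s * D h) = (*) (D h)" by (simp add: fun_eq_iff)
  ultimately show ?thesis by (simp add: has_field_derivative_def)
qed

lemma holomorphic_vec_has_derivative:
  fixes f :: "complex^'n \<Rightarrow> complex"
  assumes "holomorphic_vec f S" "z \<in> S"
  shows "(f has_derivative (\<lambda>h. \<Sum>j\<in>UNIV. h $ j * partial j f z)) (at z)"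
proof -
  obtain D where D: "(f has_derivative D) (at z)" "\<And>c v. D (c *s v) = c * D v"
    using assms unfolding holomorphic_vec_def by blast
  have p: "partial j f z = D (axis j 1)" for j
    unfolding partial_def
    using has_field_derivative_along_line[of f D z 0 "axis j 1"] D
    by (intro DERIV_imp_deriv) (simp add: axis_scalar[symmetric] axis_zero)
  have "D h = (\<Sum>j\<in>UNIV. h $ j * partial j f z)" for h
  proof -
    have "D h = D (\<Sum>j\<in>UNIV. h $ j *s axis j 1)"
      by (simp add: basis_expansion)
    also have "\<dots> = (\<Sum>j\<in>UNIV. D (h $ j *s axis j 1))"
      by (rule linear_sum[OF has_derivative_linear[OF D(1)]])
    finally show ?thesis by (simp add: D(2) p)
  qed
  then have "D = (\<lambda>h. \<Sum>j\<in>UNIV. h $ j * partial j f z)" by blast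
  then show ?thesis using D(1) by simp
qed

lemma holomorphic_vec_line_deriv:
  fixes f :: "complex^'n \<Rightarrow> complex"
  assumes "holomorphic_vec f S" "z + t *s h \<in> S"
  shows "((\<lambda>s. f (z + s *s h)) has_field_derivative (\<Sum>j\<in>UNIV. h $ j * partial j f (z + t *s h))) (at t)"
  by (rule has_field_derivative_along_line[OF holomorphic_vec_has_derivative[OF assms]])
     (simp add: sum_distrib_left mult.assoc)

lemma holomorphic_vec_partial_deriv:
  fixes f :: "complex^'n \<Rightarrow> complex"
  assumes "holomorphic_vec f S" "z \<in> S"
  shows "((\<lambda>t. f (z + axis j t)) has_field_derivative partial j f z) (at 0)"
proof -
  have "(\<Sum>k\<in>UNIV. axis j 1 $ k * partial k f z) = partial j f z"
    by (simp add: axis_def if_distrib[of "\<lambda>x. x * _"] cong: if_cong)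
  moreover have "((\<lambda>s. f (z + s *s axis j 1)) has_field_derivative
      (\<Sum>k\<in>UNIV. axis j 1 $ k * partial k f z)) (at 0)"
    using holomorphic_vec_line_deriv[of f S z 0 "axis j 1"] assms by simp
  ultimately show ?thesis
    unfolding axis_scalar[of j, symmetric] by simp
qed

lemma holomorphic_vec_along_line:
  fixes f :: "complex^'n \<Rightarrow> complex"
  assumes "holomorphic_vec f S" "\<And>t. t \<in> U \<Longrightarrow> z + t *s h \<in> S"
  shows "(\<lambda>t. f (z + t *s h)) holomorphic_on U"
  unfolding holomorphic_on_def field_differentiable_def
  using holomorphic_vec_line_deriv[OF assms(1) assms(2)] has_field_derivative_at_within by blast

lemma holomorphic_vec_continuous_on:
  "holomorphic_vec f S \<Longrightarrow> continuous_on S f"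
  unfolding holomorphic_vec_def
  by (meson continuous_at_imp_continuous_on has_derivative_continuous)

text \<open>Taylor's formula with the second derivative estimated by Cauchy's inequality on discs of
  radius \<open>R / 4\<close>.  The bound depends on \<open>g\<close> only through \<open>M\<close>, which makes it uniform over
  families of functions.\<close>

lemma first_order_remainder_bound:
  assumes g: "g holomorphic_on ball 0 R" and M: "\<And>s. s \<in> ball 0 R \<Longrightarrow> cmod (g s) \<le> M"
    and R: "R > 0" and s: "cmod s \<le> R / 2"
  shows "cmod (g s - g 0 - s * deriv g 0) \<le> 32 * M / R\<^sup>2 * (cmod s)\<^sup>2"
proof -
  have d2: "cmod ((deriv ^^ 2) g x) \<le> fact 2 * M / (R / 4) ^ 2" if x: "x \<in> cball 0 (R / 2)" for x
  proof (rule Cauchy_inequality)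
    have *: "cball x (R / 4) \<subseteq> ball 0 R"
    proof
      fix y assume "y \<in> cball x (R/4)"
      then show "y \<in> ball 0 R"
        using x R norm_triangle_ineq[of "y - x" x] by (simp add: dist_norm norm_minus_commute)
    qed
    show "continuous_on (cball x (R / 4)) g"
      using holomorphic_on_imp_continuous_on[OF g] * continuous_on_subset by blast
    show "g holomorphic_on ball x (R / 4)"
      using g * ball_subset_cball holomorphic_on_subset by blast
    show "cmod (g y) \<le> M" if "cmod (x - y) = R / 4" for y
      using M[of y] * that by (simp add: subset_iff dist_norm)
  qed (use R in simp)
  have "cmod ((deriv ^^ 0) g s - (\<Sum>i\<le>1. (deriv ^^ i) g 0 * (s - 0) ^ i / fact i))
      \<le> (fact 2 * M / (R / 4) ^ 2) * cmod (s - 0) ^ Suc 1 / fact 1"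
  proof (rule complex_Taylor[where S = "cball 0 (R / 2)"])
    fix i :: nat and x :: complex assume x: "x \<in> cball 0 (R / 2)"
    then have "x \<in> ball 0 R" using R by simp
    then show "((deriv ^^ i) g has_field_derivative (deriv ^^ Suc i) g x) (at x within cball 0 (R / 2))"
      using holomorphic_derivI[OF holomorphic_higher_deriv[OF g]] by simp
    show "cmod ((deriv ^^ Suc 1) g x) \<le> fact 2 * M / (R / 4) ^ 2"
      using d2[OF x] by (simp add: numeral_2_eq_2)
  qed (use s R in auto)
  then show ?thesis by (simp add: field_simps power2_eq_square)
qed

text \<open>Along the line through \<open>z\<close> in direction \<open>e\<close>, the remainder
  \<open>f(z + te + h) - f(z + te) - Df(z + te)h\<close> is of order \<open>|h|\<^sup>2\<close> uniformly in \<open>t\<close> (fact \<open>E1\<close>).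
  It is moreover holomorphic in \<open>t\<close>, since \<open>Df(z + te)h\<close> is a locally uniform limit of difference
  quotients (fact \<open>E2\<close>).  Cauchy's inequality therefore bounds its \<open>t\<close>-derivative at \<open>0\<close> by
  order \<open>|h|\<^sup>2\<close> as well (fact \<open>E3\<close>), and that derivative is the remainder for the partial
  derivative of \<open>f\<close>.\<close>

lemma holomorphic_vec_partial:
  fixes f :: "complex^'n \<Rightarrow> complex"
  assumes S: "open S" and f: "holomorphic_vec f S"
  shows "holomorphic_vec (partial i f) S"
  unfolding holomorphic_vec_def
proof
  fix z assume "z \<in> S"
  with S obtain q where q: "q > 0" "cball z q \<subseteq> S" by (meson open_contains_cball)
  define r where "r = q / 4"
  have r: "r > 0" using q by (simp add: r_def)
  have near: "z + h \<in> S" if "norm h \<le> 4 * r" for h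
    using q that by (auto simp: r_def dist_norm)
  have "compact (f ` cball z q)"
    using holomorphic_vec_continuous_on[OF f] q continuous_on_subset
    by (intro compact_continuous_image) auto
  then obtain M where "\<forall>y\<in>f ` cball z q. cmod y \<le> M"
    using compact_imp_bounded bounded_iff by blast
  then have M: "cmod (f (z + h)) \<le> M" if "norm h \<le> 4 * r" for h
    using that by (auto simp: r_def dist_norm)
  define e where "e = (axis i 1 :: complex^'n)"
  have ne: "norm (t *s e) = cmod t" for t by (simp add: norm_scalar_mult e_def)
  define grad where "grad = (\<lambda>h t. \<Sum>j\<in>UNIV. h $ j * partial j f (z + t *s e))"
  define C where "C = 8 * M / r\<^sup>2"
  have M0: "0 \<le> M" using M[of 0] r norm_ge_zero[of "f z"] by (simp del: norm_ge_zero)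
  have C0: "0 \<le> C" using M0 by (simp add: C_def)
  have E1: "cmod (f (z + t *s e + s *s h) - f (z + t *s e) - s * grad h t) \<le> C * (cmod s)\<^sup>2 * (norm h)\<^sup>2"
    if t: "cmod t \<le> r" and s: "cmod s \<le> 1" and h: "norm h \<le> r" for t s h
  proof (cases "h = 0")
    case True then show ?thesis by (simp add: grad_def)
  next
    case False
    \<comment> \<open>For \<open>|s| < R\<close> the point \<open>z + te + sh\<close> stays within distance \<open>3r\<close> of \<open>z\<close>.\<close>
    define R where "R = 2 * r / norm h"
    define g where "g = (\<lambda>s. f ((z + t *s e) + s *s h))"
    have R: "R > 0" using r False by (simp add: R_def)
    have nb: "norm (t *s e + s *s h) \<le> 4 * r" if "s \<in> ball 0 R" for s
    proof -
      have "cmod s * norm h \<le> 2 * r" using that False by (simp add: R_def pos_less_divide_eq less_imp_le)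
      then show ?thesis
        using norm_triangle_ineq[of "t *s e" "s *s h"] t r ne[of t] norm_scalar_mult[of s h] by linarith
    qed
    have "g holomorphic_on ball 0 R"
      unfolding g_def by (rule holomorphic_vec_along_line[OF f]) (use near[OF nb] in \<open>simp add: add.assoc\<close>)
    moreover have "cmod (g s) \<le> M" if "s \<in> ball 0 R" for s
      using M[OF nb[OF that]] by (simp add: g_def add.assoc)
    moreover have "cmod s \<le> R / 2"
    proof -
      have "1 \<le> r / norm h" using h False by simp
      then show ?thesis using s by (simp add: R_def)
    qed
    ultimately have rem: "cmod (g s - g 0 - s * deriv g 0) \<le> 32 * M / R\<^sup>2 * (cmod s)\<^sup>2"
      using R by (intro first_order_remainder_bound)
    have dg: "deriv g 0 = grad h t"
      unfolding g_def grad_def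
      using holomorphic_vec_line_deriv[OF f, of "z + t *s e" 0 h] near[of "t *s e"] t r ne
      by (intro DERIV_imp_deriv) simp
    have const: "32 * M / R\<^sup>2 = C * (norm h)\<^sup>2"
      using False r by (simp add: C_def R_def field_simps power2_eq_square)
    show ?thesis using rem unfolding const dg by (simp add: g_def mult_ac)
  qed
  have E2: "(\<lambda>t. partial j f (z + t *s e)) holomorphic_on ball 0 r" for j
  proof -
    \<comment> \<open>The \<open>j\<close>-th coordinate direction, scaled so that \<open>E1\<close> applies to it.\<close>
    define h where "h = (of_real r *s axis j 1 :: complex^'n)"
    have h: "norm h \<le> r" using r by (simp add: h_def norm_scalar_mult)
    have gr: "grad h t = of_real r * partial j f (z + t *s e)" for t
      by (simp add: grad_def h_def axis_def if_distrib[of "\<lambda>x. x * _"] if_distrib[of "\<lambda>x. _ * x"] cong: if_cong)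
    define Q where "Q = (\<lambda>s t. (f (z + t *s e + s *s h) - f (z + t *s e)) / s)"
    have "grad h holomorphic_on ball 0 r"
    proof (rule holomorphic_uniform_limit[where f = Q and F = "at 0" and z = 0 and r = r])
      have "continuous_on (cball 0 r) (Q s) \<and> Q s holomorphic_on ball 0 r" if s: "s \<noteq> 0" "cmod s < 1" for s
      proof -
        have 1: "norm (s *s h) \<le> r"
          using s h mult_mono[of "cmod s" 1 "norm h" r] by (simp add: norm_scalar_mult)
        have 2: "norm (t *s e) \<le> 2 * r" if "t \<in> ball 0 (2 * r)" for t
          using that ne by simp
        have "(\<lambda>t. f ((z + s *s h) + t *s e)) holomorphic_on ball 0 (2 * r)"
        proof (rule holomorphic_vec_along_line[OF f])
          fix t :: complex assume "t \<in> ball 0 (2 * r)"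
          then have "norm (s *s h + t *s e) \<le> 4 * r"
            using 1 2[of t] r norm_triangle_ineq[of "s *s h" "t *s e"] by linarith
          then show "z + s *s h + t *s e \<in> S" using near by (simp add: add.assoc)
        qed
        moreover have "(\<lambda>t. f (z + t *s e)) holomorphic_on ball 0 (2 * r)"
        proof (rule holomorphic_vec_along_line[OF f])
          fix t :: complex assume "t \<in> ball 0 (2 * r)"
          then show "z + t *s e \<in> S" using 2[of t] r by (intro near) linarith
        qed
        ultimately have "Q s holomorphic_on ball 0 (2 * r)"
          unfolding Q_def using s(1) by (intro holomorphic_intros) (simp_all add: add_ac)
        moreover have "cball 0 r \<subseteq> ball (0::complex) (2 * r)" "ball 0 r \<subseteq> ball (0::complex) (2 * r)"
          using r by auto
        ultimately show ?thesis
          using continuous_on_subset holomorphic_on_imp_continuous_on holomorphic_on_subset by blast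
      qed
      then show "\<forall>\<^sub>F s in at 0. continuous_on (cball 0 r) (Q s) \<and> Q s holomorphic_on ball 0 r"
        unfolding eventually_at by (intro exI[of _ 1]) (auto simp: dist_norm)
      show "uniform_limit (cball 0 r) Q (grad h) (at 0)"
      proof (rule uniform_limitI)
        fix \<epsilon> :: real assume \<epsilon>: "\<epsilon> > 0"
        define B where "B = C * (norm h)\<^sup>2 + 1"
        have B: "B > 0" using C0 by (simp add: B_def add_nonneg_pos)
        have "dist (Q s t) (grad h t) < \<epsilon>" if s: "s \<noteq> 0" "cmod s < min 1 (\<epsilon> / B)" and t: "t \<in> cball 0 r" for s t
        proof -
          have "Q s t - grad h t = (f (z + t *s e + s *s h) - f (z + t *s e) - s * grad h t) / s"
            using s by (simp add: Q_def field_simps)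
          then have "cmod (Q s t - grad h t) \<le> C * (cmod s)\<^sup>2 * (norm h)\<^sup>2 / cmod s"
            using E1[of t s h] s t h by (simp add: norm_divide divide_right_mono)
          also have "\<dots> = cmod s * (C * (norm h)\<^sup>2)"
            using s by (simp add: power2_eq_square)
          also have "\<dots> \<le> cmod s * B" by (simp add: B_def mult_left_mono)
          also have "\<dots> < \<epsilon>" using s B by (simp add: pos_less_divide_eq)
          finally show ?thesis by (simp add: dist_norm)
        qed
        moreover have "min 1 (\<epsilon> / B) > 0" using \<epsilon> B by simp
        ultimately show "\<forall>\<^sub>F s in at 0. \<forall>t\<in>cball 0 r. dist (Q s t) (grad h t) < \<epsilon>"
          unfolding eventually_at by (intro exI[of _ "min 1 (\<epsilon> / B)"]) (auto simp: dist_norm)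
      qed
    qed simp_all
    then have "(\<lambda>t. grad h t / of_real r) holomorphic_on ball 0 r"
      using r by (intro holomorphic_intros) auto
    then show ?thesis using r by (simp add: gr)
  qed
  define a where "a j = deriv (\<lambda>t. partial j f (z + t *s e)) 0" for j
  define L where "L = (\<lambda>h::complex^'n. \<Sum>j\<in>UNIV. h $ j * a j)"
  have E3: "cmod (partial i f (z + h) - partial i f z - L h) \<le> (2 * C / r) * (norm h)\<^sup>2"
    if h: "norm h \<le> r" for h
  proof -
    define \<rho> where "\<rho> = (\<lambda>t. f ((z + h) + t *s e) - f (z + t *s e) - grad h t)"
    have 2: "norm (t *s e) \<le> r" if "t \<in> ball 0 r" for t
      using that ne by simp
    have "norm (h + t *s e) \<le> 4 * r" if "t \<in> ball 0 r" for t
      using 2[OF that] h r norm_triangle_ineq[of h "t *s e"] by linarith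
    then have "(\<lambda>t. f ((z + h) + t *s e)) holomorphic_on ball 0 r"
      using near by (intro holomorphic_vec_along_line[OF f]) (simp add: add.assoc)
    moreover have "(\<lambda>t. f (z + t *s e)) holomorphic_on ball 0 r"
    proof (rule holomorphic_vec_along_line[OF f])
      fix t :: complex assume "t \<in> ball 0 r"
      then show "z + t *s e \<in> S" using 2[of t] r by (intro near) linarith
    qed
    ultimately have hol: "\<rho> holomorphic_on ball 0 r"
      unfolding \<rho>_def grad_def using E2 by (intro holomorphic_intros)
    have sub: "cball 0 (r / 2) \<subseteq> ball (0::complex) r" using r by auto
    have "cmod ((deriv ^^ 1) \<rho> 0) \<le> fact 1 * (C * (norm h)\<^sup>2) / (r / 2) ^ 1"
    proof (rule Cauchy_inequality)
      show "\<rho> holomorphic_on ball 0 (r / 2)" using hol sub ball_subset_cball holomorphic_on_subset by blast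
      show "continuous_on (cball 0 (r / 2)) \<rho>"
        using holomorphic_on_imp_continuous_on[OF hol] sub continuous_on_subset by blast
      show "cmod (\<rho> t) \<le> C * (norm h)\<^sup>2" if "cmod (0 - t) = r / 2" for t
        using E1[of t 1 h] h that r by (simp add: \<rho>_def add_ac)
    qed (use r in simp)
    moreover have d\<rho>: "(\<rho> has_field_derivative (partial i f (z + h) - partial i f z - L h)) (at 0)"
      unfolding \<rho>_def grad_def L_def
    proof (intro derivative_intros)
      have "z + h \<in> S" "z \<in> S" using near[of h] near[of 0] h r by auto
      then show "((\<lambda>t. f (z + h + t *s e)) has_field_derivative partial i f (z + h)) (at 0)"
        "((\<lambda>t. f (z + t *s e)) has_field_derivative partial i f z) (at 0)"
        unfolding e_def axis_scalar[symmetric] using holomorphic_vec_partial_deriv[OF f] by blast+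
      show "((\<lambda>t. h $ j * partial j f (z + t *s e)) has_field_derivative h $ j * a j) (at 0)" for j
        unfolding a_def using holomorphic_derivI[OF E2, of 0] r by (intro DERIV_cmult) simp
    qed
    moreover from DERIV_imp_deriv[OF d\<rho>]
    have "deriv \<rho> 0 = partial i f (z + h) - partial i f z - L h" .
    ultimately show ?thesis by (simp add: mult_ac)
  qed
  have "(partial i f has_derivative L) (at z)"
    unfolding has_derivative_at_alt
  proof (intro conjI allI impI)
    show "bounded_linear L"
      unfolding linear_conv_bounded_linear[symmetric] L_def
      by (rule linearI) (simp_all add: algebra_simps sum.distrib scaleR_sum_right)
    fix \<epsilon> :: real assume \<epsilon>: "\<epsilon> > 0"
    define B where "B = 2 * C / r + 1"
    have B: "B > 0" using C0 r by (simp add: B_def add_nonneg_pos)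
    have "norm (partial i f y - partial i f z - L (y - z)) \<le> \<epsilon> * norm (y - z)"
      if y: "norm (y - z) < min r (\<epsilon> / B)" for y
    proof -
      have "norm (partial i f y - partial i f z - L (y - z)) \<le> (2 * C / r) * (norm (y - z))\<^sup>2"
        using E3[of "y - z"] y by simp
      also have "\<dots> \<le> B * norm (y - z) * norm (y - z)"
        by (simp add: B_def power2_eq_square algebra_simps)
      also have "\<dots> \<le> \<epsilon> * norm (y - z)"
        using y B by (intro mult_right_mono) (simp_all add: pos_less_divide_eq mult.commute less_imp_le)
      finally show ?thesis .
    qed
    moreover have "min r (\<epsilon> / B) > 0" using r \<epsilon> B by simp
    ultimately show "\<exists>d>0. \<forall>y. norm (y - z) < d \<longrightarrow>
        norm (partial i f y - partial i f z - L (y - z)) \<le> \<epsilon> * norm (y - z)" by blast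
  qed
  moreover have "\<forall>c v. L (c *s v) = c * L v"
    by (simp add: L_def sum_distrib_left mult.assoc)
  ultimately show "\<exists>D. (partial i f has_derivative D) (at z) \<and> (\<forall>c v. D (c *s v) = c * D v)" by blast
qed

section \<open>The square of the domain and derivatives along coordinate axes\<close>

lemma left_pt_pt [simp]: "left_pt (pt z w) = z" and right_pt_pt [simp]: "right_pt (pt z w) = w"
  by (simp_all add: left_pt_def right_pt_def pt_def vec_eq_iff)

lemma pt_left_right: "pt (left_pt x) (right_pt x) = x"
  by (simp add: left_pt_def right_pt_def pt_def vec_eq_iff split: sum.split)

lemma mem_square: "x \<in> square \<Omega> \<longleftrightarrow> left_pt x \<in> \<Omega> \<and> right_pt x \<in> \<Omega>"
  unfolding square_def by (auto, metis pt_left_right)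

lemma pt_mem_square [simp]: "pt z w \<in> square \<Omega> \<longleftrightarrow> z \<in> \<Omega> \<and> w \<in> \<Omega>"
  by (simp add: mem_square)

lemma pt_add_axis_Inl: "pt z w + axis (Inl i) t = pt (z + axis i t) w"
  and pt_add_axis_Inr: "pt z w + axis (Inr i) t = pt z (w + axis i t)"
  by (auto simp: pt_def vec_eq_iff axis_def split: sum.split)

lemma bounded_linear_left_pt: "bounded_linear left_pt"
  and bounded_linear_right_pt: "bounded_linear right_pt"
  and bounded_linear_diag: "bounded_linear (\<lambda>z. pt z z)"
  unfolding linear_conv_bounded_linear[symmetric]
  by (rule linearI; simp add: left_pt_def right_pt_def pt_def vec_eq_iff split: sum.split)+

lemma open_square:
  assumes "open \<Omega>"
  shows "open (square \<Omega>)"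
proof -
  have "square \<Omega> = left_pt -` \<Omega> \<inter> right_pt -` \<Omega>"
    by (auto simp: mem_square)
  then show ?thesis
    using assms bounded_linear_left_pt bounded_linear_right_pt
    by (auto intro!: open_Int open_vimage linear_continuous_on)
qed

lemma holomorphic_vec_diag:
  assumes "holomorphic_vec f (square \<Omega>)"
  shows "holomorphic_vec (\<lambda>z. f (pt z z)) \<Omega>"
  unfolding holomorphic_vec_def
proof
  fix z assume "z \<in> \<Omega>"
  then obtain D where D: "(f has_derivative D) (at (pt z z))" "\<And>c v. D (c *s v) = c * D v"
    using assms unfolding holomorphic_vec_def by force
  have "((\<lambda>z. f (pt z z)) has_derivative (\<lambda>h. D (pt h h))) (at z)"
    using diff_chain_at[OF bounded_linear_imp_has_derivative[OF bounded_linear_diag] D(1)]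
    by (simp add: o_def)
  moreover have "D (pt (c *s v) (c *s v)) = c * D (pt v v)" for c v
  proof -
    have "pt (c *s v) (c *s v) = c *s pt v v" by (simp add: pt_def vec_eq_iff split: sum.split)
    then show ?thesis by (simp add: D(2))
  qed
  ultimately show "\<exists>D. ((\<lambda>z. f (pt z z)) has_derivative D) (at z) \<and> (\<forall>c v. D (c *s v) = c * D v)"
    by blast
qed

lemma holomorphic_vec_transform:
  assumes "holomorphic_vec f S" "open S" "\<And>z. z \<in> S \<Longrightarrow> f z = g z"
  shows "holomorphic_vec g S"
  unfolding holomorphic_vec_def
proof
  fix z assume z: "z \<in> S"
  then obtain D where D: "(f has_derivative D) (at z)" "\<forall>c v. D (c *s v) = c * D v"
    using assms(1) unfolding holomorphic_vec_def by blast
  have "(g has_derivative D) (at z)"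
    by (rule has_derivative_transform_within_open[OF D(1) assms(2) z assms(3)])
  with D(2) show "\<exists>D. (g has_derivative D) (at z) \<and> (\<forall>c v. D (c *s v) = c * D v)" by blast
qed

lemma holomorphic_vec_lincomb:
  assumes "holomorphic_vec f S" "holomorphic_vec g S"
  shows "holomorphic_vec (\<lambda>z. a * f z + b * g z) S"
  unfolding holomorphic_vec_def
proof
  fix z assume "z \<in> S"
  then obtain D E where "(f has_derivative D) (at z)" "\<And>c v. D (c *s v) = c * D v"
    "(g has_derivative E) (at z)" "\<And>c v. E (c *s v) = c * E v"
    using assms unfolding holomorphic_vec_def by meson
  then show "\<exists>D. ((\<lambda>z. a * f z + b * g z) has_derivative D) (at z) \<and> (\<forall>c v. D (c *s v) = c * D v)"
    by (intro exI[of _ "\<lambda>h. a * D h + b * E h"])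
       (auto intro!: derivative_intros simp: algebra_simps)
qed

lemma eventually_axis_in_open:
  fixes z :: "complex^'n"
  assumes "open S" "z \<in> S"
  shows "\<forall>\<^sub>F t in nhds 0. z + axis j t \<in> S"
proof -
  have "((\<lambda>t. z + t *s axis j 1) \<longlongrightarrow> z + 0 *s axis j 1) (nhds 0)"
    by (intro tendsto_intros bounded_linear.tendsto[OF bounded_linear_scalar_mult] filterlim_ident)
  then have "((\<lambda>t. z + axis j t) \<longlongrightarrow> z) (nhds 0)"
    by (simp add: axis_scalar[symmetric] axis_zero)
  from topological_tendstoD[OF this assms] show ?thesis .
qed

lemma DERIV_transform_eventually:
  "\<lbrakk>(f has_field_derivative d) (at a); \<forall>\<^sub>F t in nhds a. f t = g t\<rbrakk> \<Longrightarrow> (g has_field_derivative d) (at a)"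
  using DERIV_cong_ev[of a a f g d d] by simp

text \<open>Near \<open>a\<close> the continuous function \<open>g\<close> is recovered from its exponential by the principal
  logarithm, since \<open>g t - g a\<close> is small.\<close>

lemma differentiable_of_exp:
  fixes g :: "complex \<Rightarrow> complex"
  assumes "((\<lambda>t. exp (g t)) has_field_derivative d) (at a)" and g: "isCont g a"
  shows "g field_differentiable at a"
proof -
  have "((\<lambda>t. Ln (exp (g t) * exp (- g a)) + g a) has_field_derivative
      inverse (exp (g a) * exp (- g a)) * (d * exp (- g a)) + 0) (at a)"
    using assms(1)
    by (intro derivative_intros DERIV_chain2[OF has_field_derivative_Ln] DERIV_cmult_right)
       (simp add: exp_minus)
  moreover have "\<forall>\<^sub>F t in nhds a. Ln (exp (g t) * exp (- g a)) + g a = g t"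
  proof -
    have "\<forall>\<^sub>F t in nhds a. dist (g t) (g a) < 1"
      using g unfolding isCont_def tendsto_at_iff_tendsto_nhds by (rule tendstoD) simp
    then show ?thesis
    proof eventually_elim
      case (elim t)
      then have "\<bar>Im (g t - g a)\<bar> < 1"
        using abs_Im_le_cmod[of "g t - g a"] by (simp add: dist_norm)
      then have "Ln (exp (g t - g a)) = g t - g a"
        using pi_gt3 by (intro Ln_exp) linarith+
      then show ?case by (simp add: exp_diff exp_minus divide_inverse)
    qed
  qed
  ultimately show ?thesis
    unfolding field_differentiable_def using DERIV_transform_eventually by blast
qed

lemma inverse_sqrt_normalization:
  fixes \<alpha> \<beta> :: real
  assumes "\<alpha> > 0" "\<beta> > 0"
  shows "1 / sqrt (\<alpha> * \<beta> * (\<alpha> + \<beta>)) * (\<alpha> + \<beta>) * (1 / sqrt (\<alpha> * \<beta> * (\<alpha> + \<beta>)) * \<alpha> * \<beta>) = 1"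
proof -
  define s where "s = sqrt (\<alpha> * \<beta> * (\<alpha> + \<beta>))"
  have "s > 0" using assms by (simp add: s_def)
  moreover have "s * s = \<alpha> * \<beta> * (\<alpha> + \<beta>)" using assms by (simp add: s_def)
  ultimately show ?thesis unfolding s_def[symmetric] using assms by (simp add: mult.assoc nonzero_divide_eq_eq)
qed

section \<open>The derivative functionals on the tensor product\<close>

locale diagonal_setting =
  fixes \<Omega> :: "(complex^'m) set"
    and K logK :: "complex^'m \<Rightarrow> complex^'m \<Rightarrow> complex"
    and \<alpha> \<beta> :: real
    and T :: "(complex^('m + 'm) \<Rightarrow> complex) set"
    and ip :: "(complex^('m + 'm) \<Rightarrow> complex) \<Rightarrow> (complex^('m + 'm) \<Rightarrow> complex) \<Rightarrow> complex"
  assumes open_dom: "open \<Omega>"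
    and sesqui: "sesqui_analytic \<Omega> K"
    and log_branch: "continuous_log_branch \<Omega> K logK"
    and pos: "\<alpha> > 0" "\<beta> > 0"
    and rkhs: "scalar_rkhs (square \<Omega>) (tensor_kernel (kpow logK \<alpha>) (kpow logK \<beta>)) T ip"
begin

definition k :: "complex^('m + 'm) \<Rightarrow> complex^('m + 'm) \<Rightarrow> complex" where
  "k = tensor_kernel (kpow logK \<alpha>) (kpow logK \<beta>)"

text \<open>The kernel function at \<open>y\<close>, extended by \<open>0\<close> as all members of \<open>T\<close> are.\<close>

definition ksec :: "complex^('m + 'm) \<Rightarrow> complex^('m + 'm) \<Rightarrow> complex" where
  "ksec y x = (if x \<in> square \<Omega> then k x y else 0)"

definition M where "M = ortho_diff ip (A0 \<Omega> T) (A1 \<Omega> T)"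

definition h :: "'m \<Rightarrow> complex^'m \<Rightarrow> complex^'m \<Rightarrow> complex" where
  "h j w u = partial_bar j (logK u) w"

definition c :: complex where "c = of_real (1 / sqrt (\<alpha> * \<beta> * (\<alpha> + \<beta>)))"

lemma cnj_c [simp]: "cnj c = c"
  by (simp add: c_def)

abbreviation R where "R \<equiv> R1 \<Omega> \<alpha> \<beta>"

sublocale T: hilbert_set "\<lambda>c f x. c * f x" T ip
  using rkhs unfolding scalar_rkhs_def
    hilbert_function_space_iff[OF vector_space_over_itself.vector_space_axioms] by blast

lemma T_hol: "f \<in> T \<Longrightarrow> holomorphic_vec f (square \<Omega>)"
  using rkhs unfolding scalar_rkhs_def by blast

lemma ksec_in_T: "y \<in> square \<Omega> \<Longrightarrow> ksec y \<in> T"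
  and reproducing: "\<lbrakk>y \<in> square \<Omega>; f \<in> T\<rbrakk> \<Longrightarrow> ip f (ksec y) = f y"
  using rkhs unfolding scalar_rkhs_def Let_def k_def[symmetric] ksec_def[symmetric] by auto

lemma k_eq: "k x y = exp (\<alpha> * logK (left_pt x) (left_pt y) + \<beta> * logK (right_pt x) (right_pt y))"
  by (simp add: k_def tensor_kernel_def kpow_def exp_add)

lemma k_nonzero: "k x y \<noteq> 0"
  by (simp add: k_eq)

lemma k_hermitian: "\<lbrakk>x \<in> square \<Omega>; y \<in> square \<Omega>\<rbrakk> \<Longrightarrow> k y x = cnj (k x y)"
  using T.ip_commute[of "ksec y" "ksec x"] by (simp add: ksec_in_T reproducing) (simp add: ksec_def)

lemma eval_bound: "\<lbrakk>x \<in> square \<Omega>; f \<in> T\<rbrakk> \<Longrightarrow> cmod (f x) \<le> T.nrm f * sqrt (Re (k x x))"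
  using T.Cauchy_Schwarz[of f "ksec x"] by (simp add: ksec_in_T reproducing T.nrm_def) (simp add: ksec_def)

lemma continuous_k_diag: "continuous_on (square \<Omega>) (\<lambda>x. k x x)"
proof -
  have "continuous_on (square \<Omega>) (\<lambda>x. logK (p x) (p x))"
    if "bounded_linear p" "\<And>x. x \<in> square \<Omega> \<Longrightarrow> p x \<in> \<Omega>" for p :: "complex^('m + 'm) \<Rightarrow> complex^'m"
  proof -
    have "continuous_on (square \<Omega>) (\<lambda>x. (p x, p x))"
      using that(1) by (intro continuous_on_Pair linear_continuous_on)
    moreover have "continuous_on (\<Omega> \<times> \<Omega>) (\<lambda>(z, w). logK z w)"
      using log_branch unfolding continuous_log_branch_def by blast
    ultimately show ?thesis
      using continuous_on_compose2[of "\<Omega> \<times> \<Omega>" "\<lambda>(z, w). logK z w" "square \<Omega>" "\<lambda>x. (p x, p x)"] that(2)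
      by auto
  qed
  from this[OF bounded_linear_left_pt] this[OF bounded_linear_right_pt] show ?thesis
    unfolding k_eq by (auto intro!: continuous_intros simp: mem_square)
qed

text \<open>Cauchy's inequality on a circle around \<open>x\<close>, on which point evaluations are uniformly bounded
  because \<open>k(y,y)\<close> is continuous in \<open>y\<close>.\<close>

lemma partial_bounded:
  assumes x: "x \<in> square \<Omega>"
  shows "\<exists>C. \<forall>f\<in>T. cmod (partial s f x) \<le> C * T.nrm f"
proof -
  obtain r where r: "r > 0" "cball x r \<subseteq> square \<Omega>"
    using x open_square[OF open_dom] by (meson open_contains_cball)
  have "compact ((\<lambda>x. k x x) ` cball x r)"
    using continuous_on_subset[OF continuous_k_diag r(2)] by (intro compact_continuous_image) auto
  then obtain B where "\<forall>a\<in>(\<lambda>x. k x x) ` cball x r. cmod a \<le> B"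
    using compact_imp_bounded bounded_iff by blast
  then have B: "\<And>y. y \<in> cball x r \<Longrightarrow> cmod (k y y) \<le> B" by blast
  have near: "x + axis s t \<in> cball x r" if "cmod t \<le> r" for t
    using that by (simp add: dist_norm axis_scalar[of s t] norm_scalar_mult)
  have "cmod (partial s f x) \<le> (sqrt B / r) * T.nrm f" if f: "f \<in> T" for f
  proof -
    have "x + axis s t \<in> square \<Omega>" if "t \<in> cball 0 r" for t
      using near r(2) that by auto
    then have hol: "(\<lambda>t. f (x + axis s t)) holomorphic_on cball 0 r"
      using holomorphic_vec_along_line[OF T_hol[OF f], of "cball 0 r" x "axis s 1"]
      by (simp add: axis_scalar[symmetric])
    have "cmod ((deriv ^^ 1) (\<lambda>t. f (x + axis s t)) 0) \<le> fact 1 * (T.nrm f * sqrt B) / r ^ 1"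
    proof (rule Cauchy_inequality)
      show "(\<lambda>t. f (x + axis s t)) holomorphic_on ball 0 r"
        using hol ball_subset_cball holomorphic_on_subset by blast
      show "continuous_on (cball 0 r) (\<lambda>t. f (x + axis s t))"
        by (rule holomorphic_on_imp_continuous_on[OF hol])
      fix t assume "cmod (0 - t) = r"
      then have t: "x + axis s t \<in> cball x r" using near by simp
      have "cmod (f (x + axis s t)) \<le> T.nrm f * sqrt (Re (k (x + axis s t) (x + axis s t)))"
        using t r f by (intro eval_bound) auto
      also have "\<dots> \<le> T.nrm f * sqrt B"
        using order_trans[OF complex_Re_le_cmod B[OF t]] f by (intro mult_left_mono) auto
      finally show "cmod (f (x + axis s t)) \<le> T.nrm f * sqrt B" .
    qed (use r in simp)
    then show ?thesis by (simp add: partial_def mult.commute)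
  qed
  then show ?thesis by blast
qed

lemma T_partial_deriv:
  "\<lbrakk>f \<in> T; x \<in> square \<Omega>\<rbrakk> \<Longrightarrow> ((\<lambda>t. f (x + axis s t)) has_field_derivative partial s f x) (at 0)"
  using holomorphic_vec_partial_deriv[OF T_hol] by blast

lemma partial_add:
  assumes "f \<in> T" "g \<in> T" "x \<in> square \<Omega>"
  shows "partial s (f + g) x = partial s f x + partial s g x"
  unfolding partial_def[of s "f + g"] plus_fun_apply
  by (rule DERIV_imp_deriv) (use assms in \<open>intro derivative_intros T_partial_deriv\<close>)

lemma partial_scale:
  assumes "f \<in> T" "x \<in> square \<Omega>"
  shows "partial s (\<lambda>x. a * f x) x = a * partial s f x"
  unfolding partial_def[of s "\<lambda>x. a * f x"]
  by (rule DERIV_imp_deriv) (use assms in \<open>intro DERIV_cmult T_partial_deriv\<close>)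

lemma partial_represented:
  assumes x: "x \<in> square \<Omega>"
  shows "\<exists>\<delta>\<in>T. \<forall>f\<in>T. partial s f x = ip f \<delta>"
proof -
  obtain C where C: "\<And>f. f \<in> T \<Longrightarrow> cmod (partial s f x) \<le> C * T.nrm f"
    using partial_bounded[OF x] by blast
  show ?thesis
    by (rule T.Riesz[where \<phi> = "\<lambda>f. partial s f x" and C = C])
       (simp_all add: partial_add partial_scale x C)
qed

lemma R_eq:
  "z \<in> \<Omega> \<Longrightarrow> R f z $ i = c * (\<beta> * partial (Inl i) f (pt z z) - \<alpha> * partial (Inr i) f (pt z z))"
  by (simp add: R1_def c_def)

lemma R_represented:
  assumes w: "w \<in> \<Omega>"
  shows "\<exists>\<phi>\<in>T. \<forall>f\<in>T. R f w $ j = ip f \<phi>"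
proof -
  obtain \<delta> \<delta>' where d: "\<delta> \<in> T" "\<And>f. f \<in> T \<Longrightarrow> partial (Inl j) f (pt w w) = ip f \<delta>"
    "\<delta>' \<in> T" "\<And>f. f \<in> T \<Longrightarrow> partial (Inr j) f (pt w w) = ip f \<delta>'"
    using partial_represented w by (metis pt_mem_square)
  define \<phi> where "\<phi> = (\<lambda>x. (c * \<beta>) * \<delta> x) - (\<lambda>x. (c * \<alpha>) * \<delta>' x)"
  have s: "(\<lambda>x. (c * \<beta>) * \<delta> x) \<in> T" "(\<lambda>x. (c * \<alpha>) * \<delta>' x) \<in> T"
    using T.H_scale d by blast+
  then have "\<phi> \<in> T" unfolding \<phi>_def by (rule T.H_diff)
  moreover have "R f w $ j = ip f \<phi>" if "f \<in> T" for f
    unfolding \<phi>_def R_eq[OF w]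
    using that d s by (simp only: T.ip_diff_right T.ip_scale_right) (simp add: algebra_simps)
  ultimately show ?thesis by blast
qed

text \<open>The Riesz representative of the functional \<open>f \<mapsto> (R f w)\<^sub>j\<close>.\<close>

definition \<Phi> :: "complex^'m \<Rightarrow> 'm \<Rightarrow> complex^('m + 'm) \<Rightarrow> complex" where
  "\<Phi> w j = (SOME \<phi>. \<phi> \<in> T \<and> (\<forall>f\<in>T. R f w $ j = ip f \<phi>))"

lemma \<Phi>_in_T: "w \<in> \<Omega> \<Longrightarrow> \<Phi> w j \<in> T"
  and ip_\<Phi>: "\<lbrakk>w \<in> \<Omega>; f \<in> T\<rbrakk> \<Longrightarrow> ip f (\<Phi> w j) = R f w $ j"
proof -
  assume "w \<in> \<Omega>"
  then have "\<exists>\<phi>. \<phi> \<in> T \<and> (\<forall>f\<in>T. R f w $ j = ip f \<phi>)" using R_represented by blast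
  from someI_ex[OF this, folded \<Phi>_def] show "\<Phi> w j \<in> T" "f \<in> T \<Longrightarrow> ip f (\<Phi> w j) = R f w $ j" by auto
qed

section \<open>Computation of the representing vectors\<close>

text \<open>The conjugate of \<open>log K\<close> is holomorphic in its second argument because its exponential, the
  conjugate of \<open>K\<close>, is holomorphic and the branch is continuous.\<close>

lemma log_deriv:
  assumes u: "u \<in> \<Omega>" and w: "w \<in> \<Omega>"
  shows "((\<lambda>t. cnj (logK u (w + axis j t))) has_field_derivative cnj (h j w u)) (at 0)"
proof -
  have hol: "holomorphic_vec (\<lambda>v. cnj (K u v)) \<Omega>"
    using sesqui u unfolding sesqui_analytic_def by blast
  have ev: "\<forall>\<^sub>F t in nhds 0. w + axis j t \<in> \<Omega>"
    by (rule eventually_axis_in_open[OF open_dom w])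
  have "((\<lambda>t. cnj (K u (w + axis j t))) has_field_derivative partial j (\<lambda>v. cnj (K u v)) w) (at 0)"
    by (rule holomorphic_vec_partial_deriv[OF hol w])
  moreover have "\<forall>\<^sub>F t in nhds 0. cnj (K u (w + axis j t)) = exp (cnj (logK u (w + axis j t)))"
    using ev
  proof eventually_elim
    case (elim t)
    then have "K u (w + axis j t) = exp (logK u (w + axis j t))"
      using log_branch u by (simp add: continuous_log_branch_def)
    then show ?case by (simp add: exp_cnj)
  qed
  ultimately have d: "((\<lambda>t. exp (cnj (logK u (w + axis j t)))) has_field_derivative
      partial j (\<lambda>v. cnj (K u v)) w) (at 0)"
    by (rule DERIV_transform_eventually)
  have "continuous_on \<Omega> (Pair u)"
    by (intro continuous_intros)
  moreover have "continuous_on (\<Omega> \<times> \<Omega>) (\<lambda>(z, w). logK z w)"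
    using log_branch unfolding continuous_log_branch_def by blast
  ultimately have "continuous_on \<Omega> (logK u)"
    using continuous_on_compose2[of "\<Omega> \<times> \<Omega>" "\<lambda>(z, w). logK z w" \<Omega> "Pair u"] u by auto
  then have "isCont (logK u) w"
    using open_dom w by (simp add: continuous_on_eq_continuous_at)
  moreover have "isCont (\<lambda>t. w + t *s axis j 1) 0"
    by (rule isCont_add[OF continuous_const linear_continuous_at[OF bounded_linear_scalar_mult]])
  ultimately have "isCont (\<lambda>t. logK u (w + t *s axis j 1)) 0"
    using isCont_o2[of 0 "\<lambda>t. w + t *s axis j 1" "logK u"] by simp
  then have "isCont (\<lambda>t. cnj (logK u (w + t *s axis j 1))) 0"
    by (rule bounded_linear.isCont[OF bounded_linear_cnj])
  then have "(\<lambda>t. cnj (logK u (w + axis j t))) field_differentiable at 0"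
    using d by (intro differentiable_of_exp) (simp_all add: axis_scalar[symmetric])
  then show ?thesis
    by (simp add: h_def partial_bar_def partial_def field_differentiable_derivI)
qed

text \<open>The kernel function is differentiated in its argument, whereas \<open>h\<close> involves the other argument
  of \<open>log K\<close>.  The symmetry \<open>k(y,x) = cnj (k(x,y))\<close> exchanges the two.  It is used for \<open>k\<close> itself and
  not for \<open>log K\<close>, which inherits it only up to a locally constant term.\<close>

lemma partial_ksec:
  assumes x: "x \<in> square \<Omega>" and w: "w \<in> \<Omega>"
  shows "partial (Inl j) (ksec x) (pt w w) = \<alpha> * cnj (h j w (left_pt x)) * cnj (k x (pt w w))"
    and "partial (Inr j) (ksec x) (pt w w) = \<beta> * cnj (h j w (right_pt x)) * cnj (k x (pt w w))"
proof -
  have xm: "left_pt x \<in> \<Omega>" "right_pt x \<in> \<Omega>" using x by (auto simp: mem_square)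
  have ev: "\<forall>\<^sub>F t in nhds 0. w + axis j t \<in> \<Omega>"
    by (rule eventually_axis_in_open[OF open_dom w])
  have ksec_cnj: "ksec x y = exp (\<alpha> * cnj (logK (left_pt x) (left_pt y)) + \<beta> * cnj (logK (right_pt x) (right_pt y)))"
    if "y \<in> square \<Omega>" for y
  proof -
    have "ksec x y = cnj (k x y)"
      using that k_hermitian[OF x that] by (simp only: ksec_def if_True)
    then show ?thesis by (simp add: k_eq exp_cnj)
  qed
  have e0: "cnj (k x (pt w w)) = exp (\<alpha> * cnj (logK (left_pt x) w) + \<beta> * cnj (logK (right_pt x) w))"
    by (simp add: k_eq exp_cnj)
  have "((\<lambda>t. \<alpha> * cnj (logK (left_pt x) (w + axis j t)) + \<beta> * cnj (logK (right_pt x) w))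
      has_field_derivative \<alpha> * cnj (h j w (left_pt x)) + 0) (at 0)"
    by (rule DERIV_add[OF DERIV_cmult[OF log_deriv[OF xm(1) w]] DERIV_const])
  from DERIV_fun_exp[OF this]
  have "((\<lambda>t. exp (\<alpha> * cnj (logK (left_pt x) (w + axis j t)) + \<beta> * cnj (logK (right_pt x) w)))
      has_field_derivative \<alpha> * cnj (h j w (left_pt x)) * cnj (k x (pt w w))) (at 0)"
    by (simp add: e0 axis_zero mult_ac)
  moreover have "\<forall>\<^sub>F t in nhds 0. exp (\<alpha> * cnj (logK (left_pt x) (w + axis j t)) + \<beta> * cnj (logK (right_pt x) w))
      = ksec x (pt w w + axis (Inl j) t)"
    using ev by eventually_elim (simp add: pt_add_axis_Inl ksec_cnj w)
  ultimately have "((\<lambda>t. ksec x (pt w w + axis (Inl j) t)) has_field_derivative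
      \<alpha> * cnj (h j w (left_pt x)) * cnj (k x (pt w w))) (at 0)"
    by (rule DERIV_transform_eventually)
  then show "partial (Inl j) (ksec x) (pt w w) = \<alpha> * cnj (h j w (left_pt x)) * cnj (k x (pt w w))"
    unfolding partial_def by (rule DERIV_imp_deriv)
  have "((\<lambda>t. \<alpha> * cnj (logK (left_pt x) w) + \<beta> * cnj (logK (right_pt x) (w + axis j t)))
      has_field_derivative 0 + \<beta> * cnj (h j w (right_pt x))) (at 0)"
    by (rule DERIV_add[OF DERIV_const DERIV_cmult[OF log_deriv[OF xm(2) w]]])
  from DERIV_fun_exp[OF this]
  have "((\<lambda>t. exp (\<alpha> * cnj (logK (left_pt x) w) + \<beta> * cnj (logK (right_pt x) (w + axis j t))))
      has_field_derivative \<beta> * cnj (h j w (right_pt x)) * cnj (k x (pt w w))) (at 0)"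
    by (simp add: e0 axis_zero mult_ac)
  moreover have "\<forall>\<^sub>F t in nhds 0. exp (\<alpha> * cnj (logK (left_pt x) w) + \<beta> * cnj (logK (right_pt x) (w + axis j t)))
      = ksec x (pt w w + axis (Inr j) t)"
    using ev by eventually_elim (simp add: pt_add_axis_Inr ksec_cnj w)
  ultimately have "((\<lambda>t. ksec x (pt w w + axis (Inr j) t)) has_field_derivative
      \<beta> * cnj (h j w (right_pt x)) * cnj (k x (pt w w))) (at 0)"
    by (rule DERIV_transform_eventually)
  then show "partial (Inr j) (ksec x) (pt w w) = \<beta> * cnj (h j w (right_pt x)) * cnj (k x (pt w w))"
    unfolding partial_def by (rule DERIV_imp_deriv)
qed

text \<open>The value of \<open>\<Phi> w j\<close> at \<open>x\<close> is the conjugate of \<open>(R (ksec x) w)\<^sub>j\<close>.  The derivative in the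
  first group of variables contributes the factor \<open>\<alpha>\<close> with weight \<open>\<beta>\<close>, the one in the second
  group the factor \<open>\<beta>\<close> with weight \<open>-\<alpha>\<close>, which explains the common factor \<open>\<alpha>\<beta>\<close>.\<close>

lemma \<Phi>_eq:
  assumes x: "x \<in> square \<Omega>" and w: "w \<in> \<Omega>"
  shows "\<Phi> w j x = c * \<alpha> * \<beta> * (h j w (left_pt x) - h j w (right_pt x)) * k x (pt w w)"
proof -
  have "\<Phi> w j x = ip (\<Phi> w j) (ksec x)"
    by (rule reproducing[OF x \<Phi>_in_T[OF w], symmetric])
  also have "\<dots> = cnj (R (ksec x) w $ j)"
    unfolding ip_\<Phi>[OF w ksec_in_T[OF x], symmetric]
    by (rule T.ip_commute[OF ksec_in_T[OF x] \<Phi>_in_T[OF w]])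
  also have "\<dots> = c * \<alpha> * \<beta> * (h j w (left_pt x) - h j w (right_pt x)) * k x (pt w w)"
    by (simp add: R_eq w partial_ksec[OF x w] algebra_simps)
  finally show ?thesis .
qed

text \<open>The constant in front of \<open>\<Phi> w j\<close>; the normalization of \<open>R1\<close> is the one that makes
  \<open>\<gamma>_normalized\<close> true.\<close>

definition \<gamma> :: complex where "\<gamma> = c * \<alpha> * \<beta>"

lemma \<gamma>_normalized: "c * (\<alpha> + \<beta>) * \<gamma> = 1"
proof -
  have "c * (\<alpha> + \<beta>) * (c * \<alpha> * \<beta>) = of_real (1 / sqrt (\<alpha> * \<beta> * (\<alpha> + \<beta>)) *
      (\<alpha> + \<beta>) * (1 / sqrt (\<alpha> * \<beta> * (\<alpha> + \<beta>)) * \<alpha> * \<beta>))"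
    by (simp only: c_def of_real_mult of_real_add)
  then show ?thesis
    using inverse_sqrt_normalization[OF pos] by (simp only: of_real_1 \<gamma>_def)
qed

lemma \<gamma>_nonzero: "\<gamma> \<noteq> 0"
  using \<gamma>_normalized by auto

text \<open>Solving \<open>\<Phi>_eq\<close> for \<open>h\<close> expresses it through members of \<open>T\<close>, which are holomorphic; in
  this way the mixed derivatives of \<open>log K\<close> exist.\<close>

lemma h_deriv:
  assumes z: "z \<in> \<Omega>" and w: "w \<in> \<Omega>"
  shows "((\<lambda>t. h j w (z + axis i t)) has_field_derivative partial i (h j w) z) (at 0)"
proof -
  have w2: "pt w w \<in> square \<Omega>" and z2: "pt z z \<in> square \<Omega>" using w z by auto
  define F where "F = (\<lambda>t. h j w z + \<Phi> w j (pt z z + axis (Inl i) t) / (\<gamma> * ksec (pt w w) (pt z z + axis (Inl i) t)))"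
  have "ksec (pt w w) (pt z z + axis (Inl i) 0) \<noteq> 0"
    using z by (simp add: ksec_def k_nonzero axis_zero)
  then have "\<gamma> * ksec (pt w w) (pt z z + axis (Inl i) 0) \<noteq> 0"
    using \<gamma>_nonzero by simp
  from DERIV_add[OF DERIV_const[of "h j w z"] DERIV_divide[OF T_partial_deriv[OF \<Phi>_in_T[OF w, of j] z2]
        DERIV_cmult[OF T_partial_deriv[OF ksec_in_T[OF w2] z2], of \<gamma>] this]]
  obtain d where "(F has_field_derivative d) (at 0)" unfolding F_def by blast
  moreover have "\<forall>\<^sub>F t in nhds 0. F t = h j w (z + axis i t)"
    using eventually_axis_in_open[OF open_dom z, of i]
  proof eventually_elim
    case (elim t)
    then have "\<Phi> w j (pt z z + axis (Inl i) t) = \<gamma> * ksec (pt w w) (pt z z + axis (Inl i) t) * (h j w (z + axis i t) - h j w z)"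
      using z w by (simp add: pt_add_axis_Inl \<Phi>_eq ksec_def \<gamma>_def mult_ac)
    moreover have "\<gamma> * ksec (pt w w) (pt z z + axis (Inl i) t) \<noteq> 0"
      using elim z \<gamma>_nonzero k_nonzero by (simp add: pt_add_axis_Inl ksec_def)
    ultimately show ?case by (simp add: F_def)
  qed
  ultimately have "((\<lambda>t. h j w (z + axis i t)) has_field_derivative d) (at 0)"
    by (rule DERIV_transform_eventually)
  then show ?thesis unfolding partial_def using DERIV_imp_deriv by metis
qed

text \<open>On the diagonal the factor \<open>h z - h \<zeta>\<close> vanishes, so in the product rule only its own
  derivative contributes.\<close>

lemma partial_\<Phi>:
  assumes z: "z \<in> \<Omega>" and w: "w \<in> \<Omega>"
  shows "partial (Inl i) (\<Phi> w j) (pt z z) = \<gamma> * partial i (h j w) z * k (pt z z) (pt w w)"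
    and "partial (Inr i) (\<Phi> w j) (pt z z) = - (\<gamma> * partial i (h j w) z * k (pt z z) (pt w w))"
proof -
  have w2: "pt w w \<in> square \<Omega>" and z2: "pt z z \<in> square \<Omega>" using w z by auto
  have ev: "\<forall>\<^sub>F t in nhds 0. z + axis i t \<in> \<Omega>"
    by (rule eventually_axis_in_open[OF open_dom z])
  have k0: "ksec (pt w w) (pt z z) = k (pt z z) (pt w w)" using z2 by (simp add: ksec_def)
  have "((\<lambda>t. \<gamma> * (h j w (z + axis i t) - h j w z) * ksec (pt w w) (pt z z + axis (Inl i) t))
      has_field_derivative \<gamma> * partial i (h j w) z * k (pt z z) (pt w w)) (at 0)"
    using DERIV_mult[OF DERIV_cmult[OF DERIV_diff[OF h_deriv[OF z w, of j i] DERIV_const[of "h j w z"]], of \<gamma>]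
        T_partial_deriv[OF ksec_in_T[OF w2] z2, of "Inl i"]]
    by (simp add: axis_zero k0)
  moreover have "\<forall>\<^sub>F t in nhds 0. \<gamma> * (h j w (z + axis i t) - h j w z) * ksec (pt w w) (pt z z + axis (Inl i) t)
      = \<Phi> w j (pt z z + axis (Inl i) t)"
    using ev by eventually_elim (simp add: pt_add_axis_Inl \<Phi>_eq w z ksec_def \<gamma>_def)
  ultimately have "((\<lambda>t. \<Phi> w j (pt z z + axis (Inl i) t))
      has_field_derivative \<gamma> * partial i (h j w) z * k (pt z z) (pt w w)) (at 0)"
    by (rule DERIV_transform_eventually)
  then show "partial (Inl i) (\<Phi> w j) (pt z z) = \<gamma> * partial i (h j w) z * k (pt z z) (pt w w)"
    unfolding partial_def[of "Inl i"] by (rule DERIV_imp_deriv)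
  have "((\<lambda>t. \<gamma> * (h j w z - h j w (z + axis i t)) * ksec (pt w w) (pt z z + axis (Inr i) t))
      has_field_derivative - (\<gamma> * partial i (h j w) z * k (pt z z) (pt w w))) (at 0)"
    using DERIV_mult[OF DERIV_cmult[OF DERIV_diff[OF DERIV_const[of "h j w z"] h_deriv[OF z w, of j i]], of \<gamma>]
        T_partial_deriv[OF ksec_in_T[OF w2] z2, of "Inr i"]]
    by (simp add: axis_zero k0)
  moreover have "\<forall>\<^sub>F t in nhds 0. \<gamma> * (h j w z - h j w (z + axis i t)) * ksec (pt w w) (pt z z + axis (Inr i) t)
      = \<Phi> w j (pt z z + axis (Inr i) t)"
    using ev by eventually_elim (simp add: pt_add_axis_Inr \<Phi>_eq w z ksec_def \<gamma>_def)
  ultimately have "((\<lambda>t. \<Phi> w j (pt z z + axis (Inr i) t))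
      has_field_derivative - (\<gamma> * partial i (h j w) z * k (pt z z) (pt w w))) (at 0)"
    by (rule DERIV_transform_eventually)
  then show "partial (Inr i) (\<Phi> w j) (pt z z) = - (\<gamma> * partial i (h j w) z * k (pt z z) (pt w w))"
    unfolding partial_def[of "Inr i"] by (rule DERIV_imp_deriv)
qed

lemma R_\<Phi>:
  assumes z: "z \<in> \<Omega>" and w: "w \<in> \<Omega>"
  shows "R (\<Phi> w j) z $ i = KK logK \<alpha> \<beta> z w $ i $ j"
proof -
  have "R (\<Phi> w j) z $ i = (c * (\<alpha> + \<beta>) * \<gamma>) * (partial i (h j w) z * k (pt z z) (pt w w))"
    by (simp add: R_eq z partial_\<Phi>[OF z w] algebra_simps)
  also have "\<dots> = kpow logK (\<alpha> + \<beta>) z w * partial i (h j w) z"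
    unfolding \<gamma>_normalized by (simp add: k_eq kpow_def algebra_simps)
  finally show ?thesis by (simp add: KK_def h_def[abs_def])
qed

section \<open>The range of the map as a reproducing kernel space\<close>

lemma R_add:
  assumes "f \<in> T" "g \<in> T"
  shows "R (f + g) = R f + R g"
proof
  fix z
  show "R (f + g) z = (R f + R g) z"
    using assms by (cases "z \<in> \<Omega>") (simp_all add: R1_def vec_eq_iff partial_add algebra_simps)
qed

lemma R_scale:
  assumes "f \<in> T"
  shows "R (\<lambda>x. a * f x) = (\<lambda>z. a *s R f z)"
proof
  fix z
  show "R (\<lambda>x. a * f x) z = a *s R f z"
    using assms by (cases "z \<in> \<Omega>") (simp_all add: R1_def vec_eq_iff partial_scale algebra_simps)
qed

lemma R_hol:
  assumes f: "f \<in> T"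
  shows "holomorphic_vec (\<lambda>z. R f z $ i) \<Omega>"
proof -
  have "holomorphic_vec (\<lambda>z. partial s f (pt z z)) \<Omega>" for s
    by (intro holomorphic_vec_diag holomorphic_vec_partial open_square open_dom T_hol f)
  then have "holomorphic_vec (\<lambda>z. (c * \<beta>) * partial (Inl i) f (pt z z)
      + (- c * \<alpha>) * partial (Inr i) f (pt z z)) \<Omega>"
    by (intro holomorphic_vec_lincomb)
  then show ?thesis
    by (rule holomorphic_vec_transform[OF _ open_dom]) (simp add: R_eq algebra_simps)
qed

text \<open>The derivative of \<open>f\<close> along the diagonal direction \<open>(e\<^sub>i, e\<^sub>i)\<close> is the sum of the two partial
  derivatives, and it is zero as \<open>f\<close> vanishes on the diagonal.\<close>

lemma A0_partial:
  assumes f: "f \<in> A0 \<Omega> T" and z: "z \<in> \<Omega>"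
  shows "partial (Inl i) f (pt z z) = - partial (Inr i) f (pt z z)"
proof -
  define v where "v = (pt (axis i 1) (axis i 1) :: complex^('m + 'm))"
  have fT: "f \<in> T" and f0: "\<And>z. z \<in> \<Omega> \<Longrightarrow> f (pt z z) = 0" using f by (auto simp: A0_def)
  have "((\<lambda>t. f (pt z z + t *s v)) has_field_derivative (\<Sum>s\<in>UNIV. v $ s * partial s f (pt z z))) (at 0)"
    using holomorphic_vec_line_deriv[OF T_hol[OF fT], of "pt z z" 0 v] z by simp
  moreover have "\<forall>\<^sub>F t in nhds 0. f (pt z z + t *s v) = 0"
    using eventually_axis_in_open[OF open_dom z, of i]
  proof eventually_elim
    case (elim t)
    have "pt z z + t *s v = pt (z + axis i t) (z + axis i t)"
      by (simp add: v_def pt_def vec_eq_iff axis_def split: sum.split)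
    then show ?case using f0[OF elim] by simp
  qed
  ultimately have "((\<lambda>t. 0) has_field_derivative (\<Sum>s\<in>UNIV. v $ s * partial s f (pt z z))) (at (0::complex))"
    by (rule DERIV_transform_eventually)
  then have "(\<Sum>s\<in>UNIV. v $ s * partial s f (pt z z)) = 0"
    using DERIV_unique DERIV_const by blast
  moreover have "(\<Sum>s\<in>UNIV. v $ s * partial s f (pt z z)) = partial (Inl i) f (pt z z) + partial (Inr i) f (pt z z)"
    unfolding UNIV_Plus_UNIV[symmetric] sum.Plus[OF finite finite] v_def
    by (simp add: pt_def axis_def o_def if_distrib[of "\<lambda>x. x * _"] cong: if_cong)
  ultimately show ?thesis by (simp add: eq_neg_iff_add_eq_0)
qed

lemma R_on_A0:
  assumes f: "f \<in> A0 \<Omega> T" and z: "z \<in> \<Omega>"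
  shows "R f z $ i = - (c * (\<alpha> + \<beta>)) * partial (Inr i) f (pt z z)"
  by (simp add: R_eq z A0_partial[OF f z] algebra_simps)

text \<open>Vanishing on the diagonal is orthogonality to the kernel functions at diagonal points; this
  form shows that \<open>M\<close> is closed.\<close>

lemma M_eq_orth: "M = T.orth ((\<lambda>z. ksec (pt z z)) ` \<Omega> \<union> A1 \<Omega> T)"
  unfolding M_def ortho_diff_def A0_def T.orth_def ball_Un by (auto simp: reproducing)

lemma closed_subspace_M: "T.closed_subspace M"
  unfolding M_eq_orth by (rule T.closed_subspace_orth) (auto simp: A1_def ksec_in_T)

lemma M_subset: "M \<subseteq> T"
  by (auto simp: M_def ortho_diff_def A0_def)

text \<open>Orthogonality to \<open>A1\<close> is the vanishing of \<open>R\<close> on \<open>A1\<close>.\<close>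

lemma \<Phi>_in_M:
  assumes w: "w \<in> \<Omega>"
  shows "\<Phi> w j \<in> M"
proof -
  have "ip (\<Phi> w j) g = 0" if g: "g \<in> A1 \<Omega> T" for g
  proof -
    have g': "g \<in> A0 \<Omega> T" "g \<in> T" "partial (Inr j) g (pt w w) = 0"
      using g w by (auto simp: A0_def A1_def)
    have "ip g (\<Phi> w j) = 0"
      using R_on_A0[OF g'(1) w] g' by (simp add: ip_\<Phi>[OF w])
    then show ?thesis
      using T.ip_commute[OF g'(2) \<Phi>_in_T[OF w]] by simp
  qed
  then show ?thesis
    using w by (auto simp: M_def ortho_diff_def A0_def \<Phi>_in_T \<Phi>_eq)
qed

text \<open>A member of \<open>M\<close> killed by \<open>R\<close> lies in \<open>A1\<close>, hence is orthogonal to itself.\<close>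

lemma R_inj_on_M: "inj_on R M"
proof (rule inj_onI)
  fix f g assume f: "f \<in> M" and g: "g \<in> M" and eq: "R f = R g"
  have fg: "f \<in> T" "g \<in> T" using f g M_subset by auto
  define u where "u = f - g"
  have u: "u \<in> M" using f g closed_subspace_M by (simp add: u_def T.closed_subspace_def T.subspace_diff)
  then have uT: "u \<in> T" and u0: "u \<in> A0 \<Omega> T" by (auto simp: M_def ortho_diff_def A0_def)
  have "R f = R u + R g" using R_add[OF uT fg(2)] by (simp add: u_def)
  then have Ru: "R u = 0" using eq by simp
  have "u \<in> A1 \<Omega> T"
  proof -
    have "partial (Inr i) u (pt z z) = 0" if z: "z \<in> \<Omega>" for z i
    proof -
      have "- (c * (\<alpha> + \<beta>)) * partial (Inr i) u (pt z z) = 0"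
        using R_on_A0[OF u0 z, of i] Ru by simp
      moreover have "c * (\<alpha> + \<beta>) \<noteq> 0" using \<gamma>_normalized by auto
      ultimately show ?thesis by simp
    qed
    then show ?thesis using u0 by (auto simp: A0_def A1_def)
  qed
  then have "ip u u = 0" using u by (auto simp: M_def ortho_diff_def)
  then have "u = 0" using T.ip_definite uT by blast
  then show "f = g" by (simp add: u_def)
qed

definition P where "P = ortho_proj ip M"

lemma P_props:
  assumes f: "f \<in> T"
  shows P_in_M: "P f \<in> M" and ip_P: "g \<in> M \<Longrightarrow> ip (f - P f) g = 0"
proof -
  have sub: "T.subspace M" using closed_subspace_M by (simp add: T.closed_subspace_def)
  have "\<exists>!p. p \<in> M \<and> (\<forall>g\<in>M. ip (f - p) g = 0)"
    using T.projection_exists[OF closed_subspace_M f] T.projection_unique[OF sub M_subset f] by blast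
  from theI'[OF this] show "P f \<in> M" "g \<in> M \<Longrightarrow> ip (f - P f) g = 0"
    unfolding P_def ortho_proj_def fun_diff_def by blast+
qed

lemma P_id: "f \<in> M \<Longrightarrow> P f = f"
proof -
  assume f: "f \<in> M"
  have fT: "f \<in> T" using f M_subset by blast
  show ?thesis
  proof (rule T.projection_unique[OF _ M_subset fT])
    show "T.subspace M" using closed_subspace_M by (simp add: T.closed_subspace_def)
    show "\<forall>g\<in>M. ip (f - f) g = 0" using M_subset by auto
  qed (use f P_in_M[OF fT] ip_P[OF fT] in auto)
qed

text \<open>The values of \<open>R f\<close> are inner products of \<open>f\<close> with members of \<open>M\<close>.\<close>

lemma R_P: "f \<in> T \<Longrightarrow> R (P f) = R f"
proof
  fix z assume f: "f \<in> T"
  have PT: "P f \<in> T" using P_in_M[OF f] M_subset by blast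
  show "R (P f) z = R f z"
  proof (cases "z \<in> \<Omega>")
    case True
    have "R f z $ i = R (P f) z $ i" for i
      using ip_P[OF f \<Phi>_in_M[OF True, of i]]
      unfolding T.ip_diff_left[OF f PT \<Phi>_in_T[OF True]] ip_\<Phi>[OF True f] ip_\<Phi>[OF True PT] by simp
    then show ?thesis by (simp add: vec_eq_iff)
  qed (simp add: R1_def)
qed

lemma R_image: "R ` M = R ` T"
  using R_P P_in_M M_subset by (force intro: rev_image_eqI)

text \<open>The inner product of \<open>M\<close> transported along the bijection \<open>R\<close> from \<open>M\<close> onto the range.\<close>

definition ipR where
  "ipR F G = ip (the_inv_into M R F) (the_inv_into M R G)"

lemma ipR_eq: "\<lbrakk>f \<in> T; g \<in> T\<rbrakk> \<Longrightarrow> ipR (R f) (R g) = ip (P f) (P g)"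
proof -
  have "the_inv_into M R (R f) = P f" if "f \<in> T" for f
    using the_inv_into_f_f[OF R_inj_on_M P_in_M[OF that]] by (simp add: R_P that)
  then show "\<lbrakk>f \<in> T; g \<in> T\<rbrakk> \<Longrightarrow> ipR (R f) (R g) = ip (P f) (P g)" by (simp add: ipR_def)
qed

text \<open>The vector \<open>\<phi>\<close> is the combination of the \<open>\<Phi> w j\<close> with the coefficients \<open>\<eta>\<^sub>j\<close>, built up by
  induction over the index set.\<close>

lemma KK_in_range:
  assumes w: "w \<in> \<Omega>"
  shows "\<exists>\<phi>\<in>M. R \<phi> = (\<lambda>z. if z \<in> \<Omega> then KK logK \<alpha> \<beta> z w *v \<eta> else 0) \<and>
    (\<forall>f\<in>T. ip f \<phi> = (\<Sum>i\<in>UNIV. R f w $ i * cnj (\<eta> $ i)))"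
proof -
  have sub: "T.subspace M" using closed_subspace_M by (simp add: T.closed_subspace_def)
  have "\<exists>\<phi>\<in>M. R \<phi> = (\<lambda>z. if z \<in> \<Omega> then \<chi> i. \<Sum>j\<in>J. KK logK \<alpha> \<beta> z w $ i $ j * \<eta> $ j else 0) \<and>
      (\<forall>f\<in>T. ip f \<phi> = (\<Sum>i\<in>J. R f w $ i * cnj (\<eta> $ i)))" if "finite J" for J
    using that
  proof induction
    case empty
    have "R 0 = 0" using R_scale[OF T.H_zero, of 0] by (simp add: zero_fun_def)
    then have "R 0 = (\<lambda>z. if z \<in> \<Omega> then \<chi> i. \<Sum>j\<in>{}. KK logK \<alpha> \<beta> z w $ i $ j * \<eta> $ j else 0)"
      by (simp add: fun_eq_iff vec_eq_iff)
    moreover have "\<forall>f\<in>T. ip f 0 = (\<Sum>i\<in>{}. R f w $ i * cnj (\<eta> $ i))" by simp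
    ultimately show ?case using T.subspace_0[OF sub] by blast
  next
    case (insert j J)
    then obtain \<phi> where \<phi>: "\<phi> \<in> M"
      "R \<phi> = (\<lambda>z. if z \<in> \<Omega> then \<chi> i. \<Sum>j\<in>J. KK logK \<alpha> \<beta> z w $ i $ j * \<eta> $ j else 0)"
      "\<And>f. f \<in> T \<Longrightarrow> ip f \<phi> = (\<Sum>i\<in>J. R f w $ i * cnj (\<eta> $ i))" by blast
    define \<psi> where "\<psi> = (\<lambda>x. \<eta> $ j * \<Phi> w j x)"
    have \<psi>: "\<psi> \<in> M" unfolding \<psi>_def by (rule T.subspace_scale[OF sub \<Phi>_in_M[OF w]])
    have T: "\<phi> \<in> T" "\<psi> \<in> T" using \<phi> \<psi> M_subset by auto
    have "R \<psi> = (\<lambda>z. \<eta> $ j *s R (\<Phi> w j) z)"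
      unfolding \<psi>_def by (rule R_scale[OF \<Phi>_in_T[OF w]])
    then have "R (\<psi> + \<phi>) = (\<lambda>z. if z \<in> \<Omega> then \<chi> i. \<Sum>j\<in>insert j J. KK logK \<alpha> \<beta> z w $ i $ j * \<eta> $ j else 0)"
      using insert.hyps
      by (auto simp: R_add T \<phi>(2) fun_eq_iff vec_eq_iff R_\<Phi> w mult.commute) (simp add: R1_def)
    moreover have "ip f (\<psi> + \<phi>) = (\<Sum>i\<in>insert j J. R f w $ i * cnj (\<eta> $ i))" if "f \<in> T" for f
    proof -
      have "ip f \<psi> = cnj (\<eta> $ j) * ip f (\<Phi> w j)"
        unfolding \<psi>_def by (rule T.ip_scale_right[OF that \<Phi>_in_T[OF w]])
      then show ?thesis
        using insert.hyps that T by (simp add: T.ip_add_right \<phi>(3) ip_\<Phi>[OF w that] mult.commute)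
    qed
    moreover have "\<psi> + \<phi> \<in> M" using \<phi> \<psi> T.subspace_add[OF sub] by blast
    ultimately show ?case by blast
  qed
  from this[of UNIV] show ?thesis
    unfolding matrix_vector_mult_def by simp
qed

lemma matrix_rkhs_range: "matrix_rkhs \<Omega> (KK logK \<alpha> \<beta>) (R ` T) ipR"
  unfolding matrix_rkhs_def Let_def
proof (intro conjI ballI allI)
  interpret M: hilbert_set "\<lambda>c f x. c * f x" M ip
    by (rule T.hilbert_set_closed_subspace[OF closed_subspace_M])
  have "hilbert_set (\<lambda>c f z. c *s f z) (R ` M) ipR"
    unfolding ipR_def[abs_def]
  proof (rule M.hilbert_set_image[OF vector_space_fun[OF vec.vector_space_axioms] _ _ R_inj_on_M])
    show "R (f + g) = R f + R g" if "f \<in> M" "g \<in> M" for f g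
      using R_add that M_subset by blast
    show "R (\<lambda>x. a * f x) = (\<lambda>z. a *s R f z)" if "f \<in> M" for a f
      using R_scale that M_subset by blast
  qed
  then show "hilbert_function_space (*s) \<Omega> (R ` T) ipR"
    unfolding hilbert_function_space_iff[OF vec.vector_space_axioms] R_image[symmetric]
    by (auto simp: R1_def)
  show "holomorphic_vec (\<lambda>z. F z $ i) \<Omega>" if "F \<in> R ` T" for F i
    using that R_hol by auto
  fix w :: "complex^'m" and \<eta> :: "complex^'m" assume w: "w \<in> \<Omega>"
  obtain \<phi> where \<phi>: "\<phi> \<in> M" "R \<phi> = (\<lambda>z. if z \<in> \<Omega> then KK logK \<alpha> \<beta> z w *v \<eta> else 0)"
    "\<And>f. f \<in> T \<Longrightarrow> ip f \<phi> = (\<Sum>i\<in>UNIV. R f w $ i * cnj (\<eta> $ i))"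
    using KK_in_range[OF w] by blast
  have \<phi>T: "\<phi> \<in> T" using \<phi> M_subset by blast
  show "(\<lambda>z. if z \<in> \<Omega> then KK logK \<alpha> \<beta> z w *v \<eta> else 0) \<in> R ` T"
    using \<phi>(2) \<phi>T by (metis imageI)
  fix F assume "F \<in> R ` T"
  then obtain f where f: "f \<in> T" "F = R f" by blast
  have PT: "P f \<in> T" using P_in_M[OF f(1)] M_subset by blast
  have "ipR F (R \<phi>) = ip (P f) \<phi>"
    using ipR_eq[OF f(1) \<phi>T] f(2) P_id[OF \<phi>(1)] by simp
  also have "\<dots> = (\<Sum>i\<in>UNIV. F w $ i * cnj (\<eta> $ i))"
    using \<phi>(3)[OF PT] R_P[OF f(1)] f(2) by simp
  finally show "ipR F (\<lambda>z. if z \<in> \<Omega> then KK logK \<alpha> \<beta> z w *v \<eta> else 0)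
      = (\<Sum>i\<in>UNIV. F w $ i * cnj (\<eta> $ i))"
    unfolding \<phi>(2) .
qed

end

lemma matrix_rkhs_unique:
  fixes L :: "complex^'n \<Rightarrow> complex^'n \<Rightarrow> complex^'k^'k"
  assumes 1: "matrix_rkhs X L H1 ip1" and 2: "matrix_rkhs X L H2 ip2"
  shows "H1 = H2 \<and> (\<forall>f\<in>H1. \<forall>g\<in>H1. ip1 f g = ip2 f g)"
proof -
  define sec where "sec w \<eta> = (\<lambda>z. if z \<in> X then L z w *v \<eta> else 0)" for w \<eta>
  define G where "G = {sec w \<eta> | w \<eta>. w \<in> X}"
  note d = matrix_rkhs_def Let_def sec_def[symmetric]
    hilbert_function_space_iff[OF vec.vector_space_axioms]
  have r1: "ip1 f (sec w \<eta>) = (\<Sum>i\<in>UNIV. f w $ i * cnj (\<eta> $ i))" if "f \<in> H1" "w \<in> X" for f w \<eta>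
    using 1 that unfolding d by blast
  have r2: "ip2 f (sec w \<eta>) = (\<Sum>i\<in>UNIV. f w $ i * cnj (\<eta> $ i))" if "f \<in> H2" "w \<in> X" for f w \<eta>
    using 2 that unfolding d by blast
  show ?thesis
  proof (rule rkhs_unique[where G = G])
    show "hilbert_set (\<lambda>c f x. c *s f x) H1 ip1" "hilbert_set (\<lambda>c f x. c *s f x) H2 ip2"
      using 1 2 unfolding d by blast+
    show "G \<subseteq> H1" "G \<subseteq> H2" using 1 2 unfolding G_def d by blast+
    show "ip1 f g = ip2 f g" if "f \<in> H1" "f \<in> H2" "g \<in> G" for f g
      using that r1 r2 by (auto simp: G_def)
    fix f f' assume f: "f \<in> H1" "f' \<in> H2" and eq: "\<And>g. g \<in> G \<Longrightarrow> ip1 f g = ip2 f' g"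
    show "f = f'"
    proof
      fix w
      show "f w = f' w"
      proof (cases "w \<in> X")
        case True
        have "f w $ j = f' w $ j" for j
        proof -
          have "ip1 f (sec w (axis j 1)) = ip2 f' (sec w (axis j 1))"
            using True by (intro eq) (auto simp: G_def)
          then show ?thesis
            using f True by (simp add: r1 r2 axis_def if_distrib[of cnj] if_distrib[of "\<lambda>x. _ * x"] cong: if_cong)
        qed
        then show ?thesis by (simp add: vec_eq_iff)
      next
        case False
        then show ?thesis using 1 2 f unfolding d by metis
      qed
    qed
  qed
qed

theorem theorem3p3:
  fixes \<Omega> :: "(complex^'m) set"
    and K logK :: "complex^'m \<Rightarrow> complex^'m \<Rightarrow> complex"
    and \<alpha> \<beta> :: real
    and T :: "(complex^('m + 'm) \<Rightarrow> complex) set"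
    and ip :: "(complex^('m + 'm) \<Rightarrow> complex) \<Rightarrow> (complex^('m + 'm) \<Rightarrow> complex) \<Rightarrow> complex"
  assumes "open \<Omega>" and "connected \<Omega>" and "\<Omega> \<noteq> {}" and "bounded \<Omega>"
    and "sesqui_analytic \<Omega> K"
    and "continuous_log_branch \<Omega> K logK"
    and "\<alpha> > 0" and "\<beta> > 0"
    and "nonneg_definite \<Omega> (kpow logK \<alpha>)"
    and "nonneg_definite \<Omega> (kpow logK \<beta>)"
    and "scalar_rkhs (square \<Omega>) (tensor_kernel (kpow logK \<alpha>) (kpow logK \<beta>)) T ip"
  shows "(\<exists>H ipH. matrix_rkhs \<Omega> (KK logK \<alpha> \<beta>) H ipH) \<and>
    (\<forall>H ipH. matrix_rkhs \<Omega> (KK logK \<alpha> \<beta>) H ipH \<longrightarrow>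
       H = R1 \<Omega> \<alpha> \<beta> ` T \<and>
       (\<forall>f\<in>T. \<forall>g\<in>T. ipH (R1 \<Omega> \<alpha> \<beta> f) (R1 \<Omega> \<alpha> \<beta> g) =
          ip (ortho_proj ip (ortho_diff ip (A0 \<Omega> T) (A1 \<Omega> T)) f)
             (ortho_proj ip (ortho_diff ip (A0 \<Omega> T) (A1 \<Omega> T)) g)))"
proof -
  interpret diagonal_setting \<Omega> K logK \<alpha> \<beta> T ip
    using assms by unfold_locales
  have "H = R1 \<Omega> \<alpha> \<beta> ` T \<and> (\<forall>f\<in>T. \<forall>g\<in>T. ipH (R1 \<Omega> \<alpha> \<beta> f) (R1 \<Omega> \<alpha> \<beta> g) = ip (P f) (P g))"
    if "matrix_rkhs \<Omega> (KK logK \<alpha> \<beta>) H ipH" for H ipH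
    using matrix_rkhs_unique[OF that matrix_rkhs_range] ipR_eq by auto
  then show ?thesis
    using matrix_rkhs_range unfolding P_def M_def by blast
qed

end
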